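(* For every real number $s>1$, $$ 1 - \frac{(1-\gamma)^2}{1-\gamma - 2\gamma_1(s-1)} \leq [(s-1)\zeta(s)]' \leq 1- \frac{1-\gamma + 2\gamma_1(s-1)}{1 + \tfrac{1}{8}(s-1)^2}, $$ where the prime denotes differentiation with respect to $s$.
   Context: $\zeta$ denotes the Riemann zeta function. The Stieltjes constants $\gamma_n$ ($n\geq 0$) are defined by the Laurent expansion of $\zeta$ at $s=1$: $$\zeta(s) = \frac{1}{s-1} + \sum_{n=0}^{\infty}\frac{(-1)^n}{n!}\gamma_n(s-1)^n .$$ In particular $\gamma_0=\gamma=0.57721\ldots$ is the Euler--Mascheroni constant and $\gamma_1 = -0.072815\ldots$. *)

theory Defs
  imports "HOL-Complex_Analysis.Complex_Analysis"
begin

definition zeta_continuation :: "real \<Rightarrow> (complex \<Rightarrow> complex) \<Rightarrow> bool" where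
  "zeta_continuation c f \<longleftrightarrow>
     f holomorphic_on ({z. c < Re z} - {1}) \<and>
     (\<forall>z. 1 < Re z \<longrightarrow> (\<lambda>n. 1 / of_nat (Suc n) powr z) sums f z)"

text \<open>
  The Riemann zeta function is the analytic continuation of its Dirichlet series. Its value at
  \<open>s \<noteq> 1\<close> is read off from any holomorphic extension of the series to a half-plane (punctured
  at \<open>1\<close>) that contains \<open>s\<close>; by the identity theorem this does not depend on the choice
  (lemma \<open>riemann_zeta_eqI\<close>). The value at the pole is a convention.
\<close>

definition riemann_zeta :: "complex \<Rightarrow> complex" where
  "riemann_zeta s =
     (if s = 1 then 0
      else (THE w. \<exists>c f. c < Re s \<and> zeta_continuation c f \<and> w = f s))"

text \<open>
  The coefficient of \<open>(s - 1) ^ n\<close> in the Laurent expansion of zeta at \<open>1\<close> is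
  \<open>(-1) ^ n / n! * \<gamma>\<^sub>n\<close>. These coefficients are real because zeta is real on the real axis, so
  taking the real part only changes the type.
\<close>

definition stieltjes :: "nat \<Rightarrow> real" where
  "stieltjes n = Re ((-1) ^ n * fact n * fls_nth (laurent_expansion riemann_zeta 1) (int n))"

definition real_zeta :: "real \<Rightarrow> real" where
  "real_zeta s = Re (riemann_zeta (of_real s))"

lemma zeta_continuation_unique:
  assumes f: "zeta_continuation c f" and g: "zeta_continuation d g"
    and s: "c < Re s" "d < Re s" "s \<noteq> 1"
  shows "f s = g s"
proof -
  define e where "e = max c d"
  have conn: "connected ({z. e < Re z} - {1})"
  proof (rule connected_punctured_convex)
    show "convex {z. e < Re z}"
      by (rule convex_halfspace_Re_gt)
    have "aff_dim {z. e < Re z} = 2"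
    proof -
      have "of_real (e + 1) \<in> {z. e < Re z}" by simp
      then have "{z. e < Re z} \<noteq> {}" by blast
      then show ?thesis
        using aff_dim_open[of "{z. e < Re z}"] open_halfspace_Re_gt[of e] by simp
    qed
    then show "aff_dim {z. e < Re z} \<noteq> 1" by simp
  qed
  have "of_real (max 1 e + 1) \<in> {z. max 1 e < Re z}"
    unfolding mem_Collect_eq Re_complex_of_real by linarith
  then have nonempty: "{z. max 1 e < Re z} \<noteq> {}" by blast
  show ?thesis
  proof (rule analytic_continuation_open[of "{z. max 1 e < Re z}" "{z. e < Re z} - {1}" f g])
    show "open {z. max 1 e < Re z}" "open ({z. e < Re z} - {1})"
      by (intro open_delete open_halfspace_Re_gt)+
    show "{z. max 1 e < Re z} \<subseteq> {z. e < Re z} - {1}"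
      by auto
    show "f holomorphic_on {z. e < Re z} - {1}" "g holomorphic_on {z. e < Re z} - {1}"
      using f g by (auto simp: zeta_continuation_def e_def elim: holomorphic_on_subset)
    show "f z = g z" if "z \<in> {z. max 1 e < Re z}" for z
    proof (rule sums_unique2)
      show "(\<lambda>n. 1 / of_nat (Suc n) powr z) sums f z" "(\<lambda>n. 1 / of_nat (Suc n) powr z) sums g z"
        using f g that by (simp_all add: zeta_continuation_def)
    qed
    show "s \<in> {z. e < Re z} - {1}"
      using s by (simp add: e_def)
  qed (fact conn nonempty)+
qed

lemma riemann_zeta_eqI:
  assumes "zeta_continuation c f" "c < Re s" "s \<noteq> 1"
  shows "riemann_zeta s = f s"
proof -
  have "(THE w. \<exists>c f. c < Re s \<and> zeta_continuation c f \<and> w = f s) = f s"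
    using assms zeta_continuation_unique by (intro the_equality) blast+
  then show ?thesis
    using assms(3) by (simp add: riemann_zeta_def)
qed

lemma riemann_zeta_sums:
  assumes "1 < Re s"
  shows "(\<lambda>n. 1 / of_nat (Suc n) powr s) sums riemann_zeta s"
proof -
  define f :: "complex \<Rightarrow> complex" where "f = (\<lambda>z. \<Sum>n. 1 / of_nat (Suc n) powr z)"
  have bound: "norm (1 / of_nat (Suc n) powr z :: complex) \<le> real (Suc n) powr - a"
    if "a \<le> Re z" for a n z
  proof -
    have "norm (of_nat (Suc n) powr z :: complex) = real (Suc n) powr Re z"
      using norm_powr_real_powr[of "of_nat (Suc n)" z] by simp
    moreover have "real (Suc n) powr - Re z \<le> real (Suc n) powr - a"
      using that by (intro powr_mono) auto
    ultimately show ?thesis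
      by (simp add: norm_divide powr_minus_divide)
  qed
  have summable: "summable (\<lambda>n. real (Suc n) powr - a)" if "1 < a" for a
    using that summable_real_powr_iff[of "- a"]
    by (subst summable_Suc_iff[of "\<lambda>n. real n powr - a"]) auto
  have sums: "(\<lambda>n. 1 / of_nat (Suc n) powr z) sums f z" if "1 < Re z" for z
    unfolding f_def
    by (intro summable_sums summable_comparison_test'[OF summable[OF that]] bound) auto
  have "f holomorphic_on {z. 1 < Re z}"
  proof (rule holomorphic_uniform_sequence)
    show "open {z. 1 < Re z}" by (rule open_halfspace_Re_gt)
    show "(\<lambda>z. \<Sum>n<N. 1 / of_nat (Suc n) powr z) holomorphic_on {z. 1 < Re z}" for N
      by (intro holomorphic_intros) auto
  next
    fix x assume "x \<in> {z. 1 < Re z}"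
    define d where "d = (Re x - 1) / 2"
    have d: "d > 0" "1 + d \<le> Re z" if "z \<in> cball x d" for z
      using that \<open>x \<in> {z. 1 < Re z}\<close> abs_Re_le_cmod[of "x - z"]
      by (simp_all add: d_def dist_norm abs_le_iff field_simps)
    have "d > 0" using \<open>x \<in> {z. 1 < Re z}\<close> by (simp add: d_def)
    moreover have "cball x d \<subseteq> {z. 1 < Re z}"
      using d by force
    moreover have "uniform_limit (cball x d) (\<lambda>N z. \<Sum>n<N. 1 / of_nat (Suc n) powr z) f sequentially"
      unfolding f_def
    proof (rule Weierstrass_m_test)
      fix n z assume "z \<in> cball x d"
      then show "norm (1 / of_nat (Suc n) powr z :: complex) \<le> real (Suc n) powr - (1 + d)"
        by (intro bound d(2))
    next
      show "summable (\<lambda>n. real (Suc n) powr - (1 + d))"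
        by (rule summable) (use \<open>d > 0\<close> in linarith)
    qed
    ultimately show "\<exists>d>0. cball x d \<subseteq> {z. 1 < Re z} \<and>
        uniform_limit (cball x d) (\<lambda>N z. \<Sum>n<N. 1 / of_nat (Suc n) powr z) f sequentially"
      by blast
  qed
  then have "zeta_continuation 1 f"
    unfolding zeta_continuation_def using sums by (auto intro: holomorphic_on_subset)
  then have "riemann_zeta s = f s"
    using assms by (intro riemann_zeta_eqI) auto
  then show ?thesis
    using sums[OF assms] by simp
qed

end

theory Submission
  imports Defs "HOL-Real_Asymp.Real_Asymp"
begin

text \<open>
  Put \<open>u = s - 1\<close> and \<open>F u = u \<zeta> (1 + u)\<close>. This function is holomorphic on \<open>Re u > -1\<close>, and
  with \<open>c = 1 - \<gamma>\<close> and \<open>k = - 2 \<gamma>\<^sub>1\<close> its expansion at \<open>0\<close> gives \<open>1 - F' u = c - k u + O(u\<^sup>2)\<close>. The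
  theorem says that \<open>1 - F' u\<close> lies between \<open>(c - k u) / (1 + u\<^sup>2 / 8)\<close> and \<open>c\<^sup>2 / (c + k u)\<close>. Both bounds
  have the same tangent at \<open>0\<close> as \<open>1 - F'\<close>, so that small \<open>u\<close> is a question about \<open>F'''\<close>. The second
  order coefficients of the two bounds, \<open>- c / 8 \<approx> - 0.05\<close> and \<open>k\<^sup>2 / c \<approx> 0.05\<close>, leave much room around
  the true value of about \<open>0.015\<close>, and crude estimates are enough.
  
  All estimates come from one formula. By the midpoint rule, \<open>F\<close> is the locally uniform limit of
  \<open>u (\<Sum>n\<le>N. n\<^bsup>-(u+1)\<^esup>) + (N + 1/2)\<^bsup>-u\<^esup>\<close>, and therefore, up to sign, its \<open>k\<close>-th derivative is the limit of
  \<open>(\<Sum>n\<le>N. g' n) - g (N + 1/2)\<close> for \<open>g x = (ln x)\<^bsup>k\<^esup> x\<^bsup>-u\<^esup>\<close> (\<open>tendsto_zeta_times_pole_deriv\<close>); this stays true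
  at \<open>u = 0\<close>, where it yields \<open>\<gamma>\<close> and \<open>\<gamma>\<^sub>1\<close>. The difference of consecutive terms is the error of the
  midpoint rule for \<open>g'\<close> on \<open>[n - 1/2, n + 1/2]\<close>, and it is at most \<open>1/8\<close> of the increment of \<open>\<phi>\<close> as soon
  as \<open>g''' \<le> \<phi>'\<close> and \<open>\<phi>' \<ge> 0\<close>. These bounds telescope, so that a pointwise majorant of \<open>g'''\<close> controls the
  whole tail of the sum (\<open>midpoint_sum_ge\<close>, \<open>midpoint_sum_le\<close>). The majorants used are linear combinations of
  the functions \<open>(ln x)\<^bsup>j\<^esup> x\<^bsup>-(u+3)\<^esup>\<close>, whose primitives are explicit.
  
  For \<open>u \<le> 1\<close> the method, applied to \<open>F'''\<close> with two terms of the sum kept, gives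
  \<open>- 0.0697 \<le> F''' \<le> 0.0582\<close> (\<open>zeta_third_deriv_bounds\<close>), and Taylor's formula finishes the proof, given
  \<open>0.42 \<le> c \<le> 0.427\<close> and \<open>0.1435 \<le> k \<le> 0.15\<close>. For \<open>u \<ge> 1\<close> it is applied to \<open>F'\<close> itself and leads to
  rational bounds for \<open>1 - F'\<close> (\<open>zeta_deriv_ge_rational\<close>, \<open>zeta_deriv_le_rational\<close>); for \<open>u \<ge> 3\<close> the lower
  bound is no longer positive, whereas \<open>1 - F'\<close> is nonnegative.
\<close>

section \<open>The midpoint approximation of the zeta function\<close>

text \<open>
  The \<open>k\<close>-th derivative in \<open>z\<close> of \<open>z (\<Sum>n\<le>N. n\<^bsup>-(z+1)\<^esup>) + (N + 1/2)\<^bsup>-z\<^esup>\<close>. For \<open>Re z > 0\<close> the last summand is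
  \<open>z\<close> times the integral of \<open>x\<^bsup>-(z+1)\<^esup>\<close> from \<open>N + 1/2\<close> to infinity, a substitute for the tail of the series, and it
  makes sense for every \<open>z\<close>. Powers are written as \<open>exp (- z * ln n)\<close>, so that the formula is entire in \<open>z\<close>.
\<close>

definition midpoint_zeta :: "nat \<Rightarrow> nat \<Rightarrow> complex \<Rightarrow> complex" where
  "midpoint_zeta k N z =
     (\<Sum>n=1..N. (-1) ^ k * (z * of_real (ln (real n)) ^ k - of_nat k * of_real (ln (real n)) ^ (k - 1))
        * exp (- (z + 1) * of_real (ln (real n))))
     + (-1) ^ k * of_real (ln (real N + 1/2)) ^ k * exp (- z * of_real (ln (real N + 1/2)))"

lemma has_field_derivative_midpoint_zeta:
  "(midpoint_zeta k N has_field_derivative midpoint_zeta (Suc k) N z) (at z)"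
proof -
  have "((\<lambda>z. (-1) ^ k * (z * x ^ k - of_nat k * x ^ (k - 1)) * exp (- (z + 1) * x)) has_field_derivative
     (-1) ^ Suc k * (z * x ^ Suc k - of_nat (Suc k) * x ^ (Suc k - 1)) * exp (- (z + 1) * x)) (at z)" for x :: complex
  proof (rule DERIV_cong)
    have exp: "((\<lambda>z. exp (- (z + 1) * x)) has_field_derivative - x * exp (- (z + 1) * x)) (at z)"
      by (auto intro!: derivative_eq_intros)
    have lin: "((\<lambda>z. (-1) ^ k * (z * x ^ k - of_nat k * x ^ (k - 1))) has_field_derivative (-1) ^ k * x ^ k) (at z)"
      by (auto intro!: derivative_eq_intros)
    show "((\<lambda>z. (-1) ^ k * (z * x ^ k - of_nat k * x ^ (k - 1)) * exp (- (z + 1) * x)) has_field_derivative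
       (-1) ^ k * x ^ k * exp (- (z + 1) * x)
       + - x * exp (- (z + 1) * x) * ((-1) ^ k * (z * x ^ k - of_nat k * x ^ (k - 1)))) (at z)"
      by (rule DERIV_mult[OF lin exp])
    show "(-1) ^ k * x ^ k * e + - x * e * ((-1) ^ k * (z * x ^ k - of_nat k * x ^ (k - 1)))
       = (-1) ^ Suc k * (z * x ^ Suc k - of_nat (Suc k) * x ^ (Suc k - 1)) * e" for e
      by (cases k) (simp_all add: algebra_simps)
  qed
  moreover have "((\<lambda>z. (-1) ^ k * x ^ k * exp (- z * x)) has_field_derivative
     (-1) ^ Suc k * x ^ Suc k * exp (- z * x)) (at z)" for x :: complex
    by (auto intro!: derivative_eq_intros)
  ultimately show ?thesis
    unfolding midpoint_zeta_def [abs_def] by (intro DERIV_add DERIV_sum)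
qed

lemma higher_deriv_midpoint_zeta: "(deriv ^^ k) (midpoint_zeta 0 N) = midpoint_zeta k N"
proof (induction k)
  case (Suc k)
  have "deriv (midpoint_zeta k N) = midpoint_zeta (Suc k) N"
    using has_field_derivative_midpoint_zeta DERIV_imp_deriv by blast
  then show ?case by (simp add: Suc)
qed simp

lemma holomorphic_midpoint_zeta: "midpoint_zeta k N holomorphic_on A"
  using has_field_derivative_midpoint_zeta
  by (meson field_differentiable_at_within field_differentiable_def holomorphic_on_def)

lemma has_vector_derivative_exp_ln:
  fixes w :: complex
  assumes "x > 0"
  shows "((\<lambda>x. exp (- w * of_real (ln x))) has_vector_derivative - w * exp (- (w + 1) * of_real (ln x))) (at x within S)"
proof -
  have "exp (- (w + 1) * of_real (ln x)) = exp (- w * of_real (ln x)) * complex_of_real (inverse x)"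
  proof -
    have "exp (- (w + 1) * of_real (ln x)) = exp (- w * of_real (ln x)) * exp (of_real (- ln x))"
      by (simp add: algebra_simps flip: exp_add)
    also have "exp (of_real (- ln x)) = complex_of_real (exp (- ln x))"
      by (rule exp_of_real)
    also have "exp (- ln x) = inverse x"
      using assms by (simp add: exp_minus)
    finally show ?thesis .
  qed
  moreover have "((\<lambda>x. complex_of_real (ln x)) has_vector_derivative of_real (inverse x)) (at x within S)"
    using assms by (intro has_vector_derivative_of_real) (auto intro!: derivative_eq_intros simp: divide_inverse)
  then have "((\<lambda>x. exp (- w * of_real (ln x))) has_vector_derivative
     of_real (inverse x) * (exp (- w * of_real (ln x)) * - w)) (at x within S)"
    by (rule field_vector_diff_chain_within [where g = "\<lambda>y. exp (- w * y)", unfolded o_def])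
       (auto intro!: derivative_eq_intros)
  ultimately show ?thesis
    by (simp add: mult_ac)
qed

text \<open>
  The difference is the error of the one-point midpoint rule for \<open>- z x\<^bsup>-(z+1)\<^esup>\<close> on an interval of length
  one. Two applications of the mean value inequality bound it by the size of the derivative of the
  integrand, which gains the power of \<open>n\<close> that makes the differences summable down to \<open>Re z > -1\<close>.
\<close>

lemma norm_midpoint_zeta_diff_le:
  assumes "Re z > -1"
  shows "norm (midpoint_zeta 0 (Suc n) z - midpoint_zeta 0 n z)
           \<le> norm z * norm (z + 1) * (real n + 1/2) powr - (Re z + 2)"
proof -
  define a where "a = real n + 1/2"
  define S where "S = {a..a + 1}"
  define B where "B = a powr - (Re z + 2)"
  have a: "a > 0" by (simp add: a_def)
  have norm_exp: "norm (exp (- w * of_real (ln x)) :: complex) = x powr - Re w" if "x > 0" for w x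
    using that by (simp add: powr_def)
  have pos: "x > 0" if "x \<in> S" for x using that a by (auto simp: S_def)
  have bound1: "norm (exp (- (z + 1) * of_real (ln x)) - exp (- (z + 1) * of_real (ln y))) \<le> norm (z + 1) * B"
    if xy: "x \<in> S" "y \<in> S" for x y
  proof -
    have "norm (exp (- (z + 1) * of_real (ln x)) - exp (- (z + 1) * of_real (ln y)))
        \<le> norm (z + 1) * B * norm (x - y)"
    proof (rule differentiable_bound)
      show "convex S" by (simp add: S_def)
      show "((\<lambda>x. exp (- (z + 1) * of_real (ln x))) has_derivative
              (\<lambda>h. h *\<^sub>R (- (z + 1) * exp (- (z + 1 + 1) * of_real (ln x))))) (at x within S)"
        if "x \<in> S" for x
        using has_vector_derivative_exp_ln[OF pos[OF that], of "z + 1" S]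
        unfolding has_vector_derivative_def .
      show "onorm (\<lambda>h. h *\<^sub>R (- (z + 1) * exp (- (z + 1 + 1) * of_real (ln x)))) \<le> norm (z + 1) * B"
        if x: "x \<in> S" for x
      proof (rule onorm_le)
        fix h :: real
        have "x powr - (Re z + 2) \<le> B"
          unfolding B_def using x a assms by (intro powr_mono2') (auto simp: S_def)
        then have "norm (exp (- (z + 1 + 1) * of_real (ln x))) \<le> B"
          using norm_exp[OF pos[OF x], of "z + 1 + 1"] by (simp add: add.assoc)
        then show "norm (h *\<^sub>R (- (z + 1) * exp (- (z + 1 + 1) * of_real (ln x)))) \<le> norm (z + 1) * B * norm h"
          unfolding norm_scaleR norm_mult norm_minus_cancel real_norm_def
          by (metis abs_ge_zero mult.commute mult_left_mono norm_ge_zero)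
      qed
    qed (use xy in auto)
    also have "\<dots> \<le> norm (z + 1) * B * 1"
      using xy by (intro mult_left_mono) (auto simp: S_def B_def)
    finally show ?thesis by simp
  qed
  have "norm (exp (- z * of_real (ln (a + 1))) - exp (- z * of_real (ln a))
          - (a + 1 - a) *\<^sub>R (- z * exp (- (z + 1) * of_real (ln (real (Suc n))))))
        \<le> norm (a + 1 - a) * (norm z * (norm (z + 1) * B))"
  proof (rule vector_differentiable_bound_linearization[where S = S
        and f = "\<lambda>x. exp (- z * of_real (ln x))" and f' = "\<lambda>x. - z * exp (- (z + 1) * of_real (ln x))"])
    show "((\<lambda>x. exp (- z * of_real (ln x))) has_vector_derivative - z * exp (- (z + 1) * of_real (ln x))) (at x within S)"
      if "x \<in> S" for x
      by (rule has_vector_derivative_exp_ln[OF pos[OF that]])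
    show "closed_segment a (a + 1) \<subseteq> S"
      by (simp add: S_def closed_segment_eq_real_ivl)
    show mid: "real (Suc n) \<in> S" by (simp add: S_def a_def)
    show "norm (- z * exp (- (z + 1) * of_real (ln x)) - - z * exp (- (z + 1) * of_real (ln (real (Suc n)))))
             \<le> norm z * (norm (z + 1) * B)" if x: "x \<in> S" for x
    proof -
      have "- z * exp (- (z + 1) * of_real (ln x)) - - z * exp (- (z + 1) * of_real (ln (real (Suc n))))
         = - z * (exp (- (z + 1) * of_real (ln x)) - exp (- (z + 1) * of_real (ln (real (Suc n)))))"
        by (simp only: right_diff_distrib)
      also have "norm \<dots> \<le> norm z * (norm (z + 1) * B)"
        unfolding norm_mult norm_minus_cancel by (intro mult_left_mono bound1 x mid norm_ge_zero)
      finally show ?thesis .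
    qed
  qed
  moreover have "midpoint_zeta 0 (Suc n) z - midpoint_zeta 0 n z =
     exp (- z * of_real (ln (a + 1))) - exp (- z * of_real (ln a))
          - (a + 1 - a) *\<^sub>R (- z * exp (- (z + 1) * of_real (ln (real (Suc n)))))"
    by (simp add: midpoint_zeta_def a_def add_ac)
  ultimately show ?thesis
    by (simp add: B_def a_def mult_ac)
qed

text \<open>
  The function \<open>z \<zeta> (1 + z)\<close>, with the pole at \<open>z = 0\<close> removed.
\<close>

definition zeta_times_pole :: "complex \<Rightarrow> complex" where
  "zeta_times_pole z = lim (\<lambda>N. midpoint_zeta 0 N z)"

lemma uniform_limit_midpoint_zeta:
  assumes "Re z > -1"
  obtains d where "d > 0" "cball z d \<subseteq> {w. Re w > -1}"
    "uniform_limit (cball z d) (midpoint_zeta 0) zeta_times_pole sequentially"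
proof -
  define d where "d = (Re z + 1) / 2"
  have d: "d > 0" using assms by (simp add: d_def)
  have Re: "Re w \<ge> d - 1" and norm: "norm w \<le> norm z + d" if "w \<in> cball z d" for w
  proof -
    have "Re z - Re w \<le> d" using that abs_Re_le_cmod[of "z - w"] by (simp add: dist_norm)
    then show "Re w \<ge> d - 1" by (simp add: d_def field_simps)
    show "norm w \<le> norm z + d"
      using that norm_triangle_ineq3[of w z] by (simp add: dist_norm norm_minus_commute)
  qed
  define R where "R = (norm z + d) * (norm z + d + 1)"
  define M where "M n = R * real n powr - (d + 1)" for n
  have bound: "norm (midpoint_zeta 0 (Suc n) w - midpoint_zeta 0 n w) \<le> M n"
    if w: "w \<in> cball z d" and n: "n \<ge> 1" for w n
  proof -
    have "norm (midpoint_zeta 0 (Suc n) w - midpoint_zeta 0 n w)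
        \<le> norm w * norm (w + 1) * (real n + 1/2) powr - (Re w + 2)"
      using Re[OF w] d by (intro norm_midpoint_zeta_diff_le) linarith
    also have "(real n + 1/2) powr - (Re w + 2) \<le> (real n + 1/2) powr - (d + 1)"
      using Re[OF w] n by (intro powr_mono) auto
    also have "(real n + 1/2) powr - (d + 1) \<le> real n powr - (d + 1)"
      using n d by (intro powr_mono2') auto
    also have "norm w * norm (w + 1) \<le> R"
      unfolding R_def using norm[OF w] norm_triangle_ineq[of w 1] d
      by (intro mult_mono) auto
    finally show ?thesis by (simp add: M_def mult_left_mono mult_right_mono)
  qed
  have "summable M"
    unfolding M_def using d by (intro summable_mult) (simp add: summable_real_powr_iff)
  then have lim: "uniform_limit (cball z d)
       (\<lambda>N w. \<Sum>n<N. midpoint_zeta 0 (Suc n) w - midpoint_zeta 0 n w)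
       (\<lambda>w. \<Sum>n. midpoint_zeta 0 (Suc n) w - midpoint_zeta 0 n w) sequentially"
    by (rule Weierstrass_m_test_ev[rotated])
       (auto intro!: eventually_sequentiallyI[of 1] bound)
  have "uniform_limit (cball z d)
       (\<lambda>N w. midpoint_zeta 0 0 w + (\<Sum>n<N. midpoint_zeta 0 (Suc n) w - midpoint_zeta 0 n w))
       (\<lambda>w. midpoint_zeta 0 0 w + (\<Sum>n. midpoint_zeta 0 (Suc n) w - midpoint_zeta 0 n w)) sequentially"
    by (intro uniform_limit_add uniform_limit_const lim)
  then have "uniform_limit (cball z d) (midpoint_zeta 0)
       (\<lambda>w. midpoint_zeta 0 0 w + (\<Sum>n. midpoint_zeta 0 (Suc n) w - midpoint_zeta 0 n w)) sequentially"
    by (simp add: sum_lessThan_telescope[of "\<lambda>n. midpoint_zeta 0 n w" for w])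
  moreover have "midpoint_zeta 0 0 w + (\<Sum>n. midpoint_zeta 0 (Suc n) w - midpoint_zeta 0 n w) = zeta_times_pole w"
    if "w \<in> cball z d" for w
    using tendsto_uniform_limitI[OF calculation that] by (simp add: zeta_times_pole_def limI)
  ultimately have "uniform_limit (cball z d) (midpoint_zeta 0) zeta_times_pole sequentially"
    by (metis (no_types, lifting) uniform_limit_cong')
  moreover have "cball z d \<subseteq> {w. Re w > -1}"
    using Re d by force
  ultimately show ?thesis using d that by blast
qed

lemma holomorphic_zeta_times_pole: "zeta_times_pole holomorphic_on {z. Re z > -1}"
proof (rule holomorphic_uniform_sequence)
  show "open {z. Re z > -1}" by (rule open_halfspace_Re_gt)
  show "midpoint_zeta 0 N holomorphic_on {z. Re z > -1}" for N
    by (rule holomorphic_midpoint_zeta)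
  show "\<exists>d>0. cball x d \<subseteq> {z. Re z > -1} \<and> uniform_limit (cball x d) (midpoint_zeta 0) zeta_times_pole sequentially"
    if "x \<in> {z. Re z > -1}" for x
    using that uniform_limit_midpoint_zeta[of x] by blast
qed

text \<open>
  Locally uniform convergence of holomorphic functions passes to all derivatives.
\<close>

lemma tendsto_higher_deriv_zeta_times_pole:
  assumes "Re z > -1"
  shows "(\<lambda>N. midpoint_zeta k N z) \<longlonglongrightarrow> (deriv ^^ k) zeta_times_pole z"
proof -
  obtain d where d: "d > 0" "uniform_limit (cball z d) (midpoint_zeta 0) zeta_times_pole sequentially"
    using uniform_limit_midpoint_zeta[OF assms] by blast
  have "(\<lambda>N. (deriv ^^ k) (midpoint_zeta 0 N) z) \<longlonglongrightarrow> (deriv ^^ k) zeta_times_pole z"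
  proof (rule higher_deriv_complex_uniform_limit)
    show "uniform_limit (ball z d) (midpoint_zeta 0) zeta_times_pole sequentially"
      using d(2) by (rule uniform_limit_on_subset) auto
  qed (use d(1) holomorphic_midpoint_zeta in auto)
  then show ?thesis by (simp add: higher_deriv_midpoint_zeta)
qed

text \<open>
  To the right of \<open>1\<close> the correction term \<open>(N + 1/2)\<^bsup>-z\<^esup>\<close> tends to zero and the Dirichlet series remains.
\<close>

lemma zeta_continuation_zeta_times_pole:
  "zeta_continuation 0 (\<lambda>s. zeta_times_pole (s - 1) / (s - 1))"
  unfolding zeta_continuation_def
proof (intro conjI allI impI)
  have "(\<lambda>s. zeta_times_pole (s - 1)) holomorphic_on {s. 0 < Re s} - {1}"
    by (intro holomorphic_on_compose_gen[OF _ holomorphic_zeta_times_pole, of "\<lambda>s. s - 1", unfolded o_def]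
          holomorphic_intros) auto
  then show "(\<lambda>s. zeta_times_pole (s - 1) / (s - 1)) holomorphic_on {s. 0 < Re s} - {1}"
    by (intro holomorphic_intros) auto
next
  fix s :: complex assume s: "1 < Re s"
  have s1: "s \<noteq> 1" using s by auto
  have "(\<lambda>N. midpoint_zeta 0 N (s - 1)) \<longlonglongrightarrow> zeta_times_pole (s - 1)"
    using tendsto_higher_deriv_zeta_times_pole[of "s - 1" 0] s by simp
  moreover have "(\<lambda>N. exp (- (s - 1) * of_real (ln (real N + 1/2)))) \<longlonglongrightarrow> 0"
  proof (rule tendsto_norm_zero_cancel)
    have "((\<lambda>N. (real N + 1/2) powr - (Re s - 1)) \<longlongrightarrow> 0) sequentially"
      by (rule tendsto_neg_powr) (use s in simp, real_asymp)
    moreover have "norm (exp (- (s - 1) * of_real (ln (real N + 1/2)))) = (real N + 1/2) powr - (Re s - 1)" for N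
      by (simp add: powr_def)
    ultimately show "(\<lambda>N. norm (exp (- (s - 1) * of_real (ln (real N + 1/2))))) \<longlonglongrightarrow> 0"
      by simp
  qed
  ultimately have "(\<lambda>N. (midpoint_zeta 0 N (s - 1) - exp (- (s - 1) * of_real (ln (real N + 1/2)))) / (s - 1))
      \<longlonglongrightarrow> (zeta_times_pole (s - 1) - 0) / (s - 1)"
    using s1 by (intro tendsto_intros) auto
  moreover have "(midpoint_zeta 0 N (s - 1) - exp (- (s - 1) * of_real (ln (real N + 1/2)))) / (s - 1)
      = (\<Sum>n<N. 1 / of_nat (Suc n) powr s)" for N
  proof -
    have "1 / of_nat (Suc n) powr s = exp (- s * of_real (ln (real (Suc n))))" for n
      by (simp add: powr_def exp_minus divide_inverse Ln_of_nat del: of_nat_Suc)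
    then have "(\<Sum>n<N. 1 / of_nat (Suc n) powr s) = (\<Sum>n=1..N. exp (- s * of_real (ln (real n))))"
      by (simp only: One_nat_def sum.atLeast1_atMost_eq)
    then show ?thesis
      using s1 by (simp add: midpoint_zeta_def flip: sum_distrib_left)
  qed
  ultimately show "(\<lambda>n. 1 / of_nat (Suc n) powr s) sums (zeta_times_pole (s - 1) / (s - 1))"
    by (simp add: sums_def)
qed

lemma riemann_zeta_eq:
  assumes "0 < Re s" "s \<noteq> 1"
  shows "riemann_zeta s = zeta_times_pole (s - 1) / (s - 1)"
  using riemann_zeta_eqI[OF zeta_continuation_zeta_times_pole] assms by simp

text \<open>
  Dividing by \<open>z\<close> shifts the Taylor coefficients of \<open>z \<zeta> (1 + z)\<close> by one, so the coefficient of \<open>s - 1\<close> in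
  the Laurent expansion of zeta is half of the second derivative at \<open>0\<close>.
\<close>

lemma stieltjes_1_eq: "stieltjes 1 = - Re ((deriv ^^ 2) zeta_times_pole 0) / 2"
proof -
  have "zeta_times_pole has_fps_expansion fps_expansion zeta_times_pole 0"
    by (rule has_fps_expansion_fps_expansion[OF open_halfspace_Re_gt _ holomorphic_zeta_times_pole]) auto
  from has_laurent_expansion_shift'[OF has_laurent_expansion_fps[OF this], of 1]
  have "(\<lambda>w. zeta_times_pole w * w powi (- 1)) has_laurent_expansion
     fls_shift 1 (fps_to_fls (fps_expansion zeta_times_pole 0))" .
  also have "?this \<longleftrightarrow> (\<lambda>w. riemann_zeta (1 + w)) has_laurent_expansion
     fls_shift 1 (fps_to_fls (fps_expansion zeta_times_pole 0))"
  proof (rule has_laurent_expansion_cong)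
    have "eventually (\<lambda>w. w \<in> ball 0 1 - {0}) (at (0::complex))"
      by (rule eventually_at_in_open) auto
    then show "eventually (\<lambda>w. zeta_times_pole w * w powi (- 1) = riemann_zeta (1 + w)) (at 0)"
    proof eventually_elim
      case (elim w)
      then have "\<bar>Re w\<bar> < 1" using abs_Re_le_cmod[of w] by simp
      then show ?case using elim
        by (subst riemann_zeta_eq) (auto simp: divide_inverse)
    qed
  qed simp
  finally have "laurent_expansion riemann_zeta 1 = fls_shift 1 (fps_to_fls (fps_expansion zeta_times_pole 0))"
    by (rule laurent_expansion_eqI)
  then show ?thesis
    by (simp add: stieltjes_def fps_expansion_def numeral_2_eq_2)
qed

definition zeta_times_pole_deriv :: "nat \<Rightarrow> real \<Rightarrow> real" where
  "zeta_times_pole_deriv k u = Re ((deriv ^^ k) zeta_times_pole (of_real u))"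

lemma DERIV_zeta_times_pole_deriv:
  assumes "u > -1"
  shows "(zeta_times_pole_deriv k has_real_derivative zeta_times_pole_deriv (Suc k) u) (at u)"
proof -
  have "(deriv ^^ k) zeta_times_pole holomorphic_on {z. Re z > -1}"
    by (intro holomorphic_higher_deriv holomorphic_zeta_times_pole open_halfspace_Re_gt)
  then have "((deriv ^^ k) zeta_times_pole has_field_derivative (deriv ^^ Suc k) zeta_times_pole (of_real u)) (at (of_real u))"
    using holomorphic_derivI[OF _ open_halfspace_Re_gt] assms by fastforce
  then show ?thesis
    unfolding zeta_times_pole_deriv_def [abs_def]
    by (intro has_field_derivative_Re has_vector_derivative_real_field)
qed

lemma deriv_real_zeta:
  assumes "s > 1"
  shows "deriv (\<lambda>t. (t - 1) * real_zeta t) s = zeta_times_pole_deriv 1 (s - 1)"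
proof (rule DERIV_imp_deriv)
  have "((\<lambda>t. zeta_times_pole_deriv 0 (t - 1)) has_real_derivative zeta_times_pole_deriv 1 (s - 1)) (at s)"
    using DERIV_chain2[of "zeta_times_pole_deriv 0" "zeta_times_pole_deriv 1 (s - 1)" "\<lambda>t. t - 1" s 1 UNIV]
      DERIV_zeta_times_pole_deriv[of "s - 1" 0] assms
    by (simp add: DERIV_diff[OF DERIV_ident DERIV_const, simplified])
  moreover have "zeta_times_pole_deriv 0 (t - 1) = (t - 1) * real_zeta t" if "t \<in> {1<..}" for t
  proof -
    have "riemann_zeta (of_real t) = zeta_times_pole (of_real (t - 1)) / of_real (t - 1)"
      using that by (subst riemann_zeta_eq) auto
    then show ?thesis
      using that by (simp add: real_zeta_def zeta_times_pole_deriv_def Re_divide_of_real del: of_real_diff)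
  qed
  ultimately show "((\<lambda>t. (t - 1) * real_zeta t) has_real_derivative zeta_times_pole_deriv 1 (s - 1)) (at s)"
    using assms by (auto intro: has_field_derivative_transform_within_open[where S = "{1<..}"])
qed

section \<open>Sums and the midpoint rule\<close>

text \<open>
  The left-hand side, as a function of \<open>h\<close>, vanishes to second order at \<open>0\<close>, and its second derivative is
  \<open>g2 (c + h) - g2 (c - h)\<close>. This is at most the increment of \<open>\<phi>\<close>; integrating twice gives the factor
  \<open>h\<^sup>2 / 2\<close>.
\<close>

lemma midpoint_rule_error_le:
  fixes g g1 g2 \<phi> :: "real \<Rightarrow> real"
  assumes h: "h \<ge> 0"
    and g: "\<And>x. x \<in> {c - h..c + h} \<Longrightarrow> (g has_real_derivative g1 x) (at x)"
    and g1: "\<And>x. x \<in> {c - h..c + h} \<Longrightarrow> (g1 has_real_derivative g2 x) (at x)"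
    and growth: "\<And>x y. c - h \<le> x \<Longrightarrow> x \<le> y \<Longrightarrow> y \<le> c + h \<Longrightarrow> g2 y - g2 x \<le> \<phi> y - \<phi> x"
    and mono: "\<And>x y. c - h \<le> x \<Longrightarrow> x \<le> y \<Longrightarrow> y \<le> c + h \<Longrightarrow> \<phi> x \<le> \<phi> y"
  shows "g (c + h) - g (c - h) - 2 * h * g1 c \<le> h\<^sup>2 / 2 * (\<phi> (c + h) - \<phi> (c - h))"
proof -
  define D where "D = \<phi> (c + h) - \<phi> (c - h)"
  define w where "w t = g (c + t) - g (c - t) - 2 * t * g1 c - t\<^sup>2 / 2 * D" for t
  define w1 where "w1 t = g1 (c + t) + g1 (c - t) - 2 * g1 c - t * D" for t
  have w: "(w has_real_derivative w1 t) (at t)" if "0 \<le> t" "t \<le> h" for t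
  proof -
    have "((\<lambda>t. g (c + t)) has_real_derivative g1 (c + t)) (at t)"
      by (rule DERIV_chain2[of g _ "\<lambda>t. c + t" t 1, simplified])
         (use that in \<open>auto intro!: g derivative_eq_intros\<close>)
    moreover have "((\<lambda>t. g (c - t)) has_real_derivative - g1 (c - t)) (at t)"
      by (rule DERIV_chain2[of g _ "\<lambda>t. c - t" t "-1", simplified])
         (use that in \<open>auto intro!: g derivative_eq_intros\<close>)
    ultimately show ?thesis
      unfolding w_def [abs_def] w1_def
      by (auto intro!: derivative_eq_intros)
  qed
  have w1: "(w1 has_real_derivative g2 (c + t) - g2 (c - t) - D) (at t)" if "0 \<le> t" "t \<le> h" for t
  proof -
    have "((\<lambda>t. g1 (c + t)) has_real_derivative g2 (c + t)) (at t)"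
      by (rule DERIV_chain2[of g1 _ "\<lambda>t. c + t" t 1, simplified])
         (use that in \<open>auto intro!: g1 derivative_eq_intros\<close>)
    moreover have "((\<lambda>t. g1 (c - t)) has_real_derivative - g2 (c - t)) (at t)"
      by (rule DERIV_chain2[of g1 _ "\<lambda>t. c - t" t "-1", simplified])
         (use that in \<open>auto intro!: g1 derivative_eq_intros\<close>)
    ultimately show ?thesis
      unfolding w1_def [abs_def]
      by (auto intro!: derivative_eq_intros)
  qed
  have w2_nonpos: "g2 (c + t) - g2 (c - t) - D \<le> 0" if t: "0 \<le> t" "t \<le> h" for t
  proof -
    have "g2 (c + t) - g2 (c - t) \<le> \<phi> (c + t) - \<phi> (c - t)" using t by (intro growth) auto
    moreover have "\<phi> (c + t) \<le> \<phi> (c + h)" "\<phi> (c - h) \<le> \<phi> (c - t)" using t by (auto intro!: mono)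
    ultimately show ?thesis by (simp add: D_def)
  qed
  have w1_nonpos: "w1 t \<le> 0" if t: "0 \<le> t" "t \<le> h" for t
  proof -
    have "w1 t \<le> w1 0"
      using t(1)
    proof (rule DERIV_nonpos_imp_nonincreasing)
      fix x assume "0 \<le> x" "x \<le> t"
      then show "\<exists>y. (w1 has_real_derivative y) (at x) \<and> y \<le> 0"
        using t w1[of x] w2_nonpos[of x] by auto
    qed
    then show ?thesis by (simp add: w1_def)
  qed
  have "w h \<le> w 0"
    using h
  proof (rule DERIV_nonpos_imp_nonincreasing)
    fix x assume "0 \<le> x" "x \<le> h"
    then show "\<exists>y. (w has_real_derivative y) (at x) \<and> y \<le> 0"
      using w[of x] w1_nonpos[of x] by auto
  qed
  then show ?thesis by (simp add: w_def D_def)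
qed

text \<open>
  The tail bound on which all later estimates rest. For \<open>n > m\<close> each step from \<open>n - 1/2\<close> to \<open>n + 1/2\<close>
  loses at most one eighth of the increment of \<open>\<phi>\<close>, so that in total at most \<open>- \<phi> (m + 1/2) / 8\<close> is
  lost. The first \<open>m\<close> terms are kept exactly.
\<close>

lemma midpoint_sum_ge:
  fixes g g1 g2 g3 \<phi> \<phi>' :: "real \<Rightarrow> real"
  assumes g: "\<And>x. x \<ge> real m + 1/2 \<Longrightarrow> (g has_real_derivative g1 x) (at x)"
    and g1: "\<And>x. x \<ge> real m + 1/2 \<Longrightarrow> (g1 has_real_derivative g2 x) (at x)"
    and g2: "\<And>x. x \<ge> real m + 1/2 \<Longrightarrow> (g2 has_real_derivative g3 x) (at x)"
    and \<phi>: "\<And>x. x \<ge> real m + 1/2 \<Longrightarrow> (\<phi> has_real_derivative \<phi>' x) (at x)"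
    and le: "\<And>x. x \<ge> real m + 1/2 \<Longrightarrow> g3 x \<le> \<phi>' x"
    and nonneg: "\<And>x. x \<ge> real m + 1/2 \<Longrightarrow> 0 \<le> \<phi>' x"
    and nonpos: "\<And>x. x \<ge> real m + 1/2 \<Longrightarrow> \<phi> x \<le> 0"
    and lim: "(\<lambda>N. (\<Sum>n=1..N. g1 (real n)) - g (real N + 1/2)) \<longlonglongrightarrow> l"
  shows "(\<Sum>n=1..m. g1 (real n)) - g (real m + 1/2) + \<phi> (real m + 1/2) / 8 \<le> l"
proof -
  define S where "S N = (\<Sum>n=1..N. g1 (real n)) - g (real N + 1/2)" for N
  have mono: "\<phi> x \<le> \<phi> y" if "real m + 1/2 \<le> x" "x \<le> y" for x y
    using that(2)
  proof (rule DERIV_nonneg_imp_nondecreasing)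
    fix t assume "x \<le> t" "t \<le> y"
    then show "\<exists>d. (\<phi> has_real_derivative d) (at t) \<and> 0 \<le> d"
      using that \<phi>[of t] nonneg[of t] by auto
  qed
  have growth: "g2 y - g2 x \<le> \<phi> y - \<phi> x" if "real m + 1/2 \<le> x" "x \<le> y" for x y
  proof -
    have "g2 y - \<phi> y \<le> g2 x - \<phi> x"
      using that(2)
    proof (rule DERIV_nonpos_imp_nonincreasing)
      fix t assume "x \<le> t" "t \<le> y"
      then show "\<exists>d. ((\<lambda>x. g2 x - \<phi> x) has_real_derivative d) (at t) \<and> d \<le> 0"
        using that DERIV_diff[OF g2[of t] \<phi>[of t]] le[of t] by auto
    qed
    then show ?thesis by simp
  qed
  have step: "S m + \<phi> (real m + 1/2) / 8 - \<phi> (real N + 1/2) / 8 \<le> S N" if "m \<le> N" for N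
    using that
  proof (induction N rule: dec_induct)
    case (step N)
    have "g (real (Suc N) + 1/2) - g (real (Suc N) - 1/2) - 2 * (1/2) * g1 (real (Suc N))
          \<le> (1/2)\<^sup>2 / 2 * (\<phi> (real (Suc N) + 1/2) - \<phi> (real (Suc N) - 1/2))"
      by (rule midpoint_rule_error_le) (use step.hyps in \<open>auto intro!: g g1 mono growth\<close>)
    moreover have shift: "real (Suc N) - 1/2 = real N + 1/2" by simp
    ultimately have "g (real (Suc N) + 1/2) - g (real N + 1/2) - g1 (real (Suc N))
          \<le> (\<phi> (real (Suc N) + 1/2) - \<phi> (real N + 1/2)) / 8"
      unfolding shift power2_eq_square by linarith
    moreover have "S (Suc N) = S N + g1 (real (Suc N)) - g (real (Suc N) + 1/2) + g (real N + 1/2)"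
      by (simp add: S_def)
    ultimately show ?case using step.IH by (simp only: diff_divide_distrib)
  qed simp
  have "S m + \<phi> (real m + 1/2) / 8 \<le> S N" if "m \<le> N" for N
    using step[OF that] nonpos[of "real N + 1/2"] that by simp
  then have "\<forall>\<^sub>F N in sequentially. S m + \<phi> (real m + 1/2) / 8 \<le> S N"
    by (rule eventually_sequentiallyI)
  with lim show ?thesis
    unfolding S_def by (rule tendsto_lowerbound) simp
qed

lemma midpoint_sum_le:
  fixes g g1 g2 g3 \<phi> \<phi>' :: "real \<Rightarrow> real"
  assumes g: "\<And>x. x \<ge> real m + 1/2 \<Longrightarrow> (g has_real_derivative g1 x) (at x)"
    and g1: "\<And>x. x \<ge> real m + 1/2 \<Longrightarrow> (g1 has_real_derivative g2 x) (at x)"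
    and g2: "\<And>x. x \<ge> real m + 1/2 \<Longrightarrow> (g2 has_real_derivative g3 x) (at x)"
    and \<phi>: "\<And>x. x \<ge> real m + 1/2 \<Longrightarrow> (\<phi> has_real_derivative \<phi>' x) (at x)"
    and le: "\<And>x. x \<ge> real m + 1/2 \<Longrightarrow> - g3 x \<le> \<phi>' x"
    and nonneg: "\<And>x. x \<ge> real m + 1/2 \<Longrightarrow> 0 \<le> \<phi>' x"
    and nonpos: "\<And>x. x \<ge> real m + 1/2 \<Longrightarrow> \<phi> x \<le> 0"
    and lim: "(\<lambda>N. (\<Sum>n=1..N. g1 (real n)) - g (real N + 1/2)) \<longlonglongrightarrow> l"
  shows "l \<le> (\<Sum>n=1..m. g1 (real n)) - g (real m + 1/2) - \<phi> (real m + 1/2) / 8"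
proof -
  have "(\<lambda>N. (\<Sum>n=1..N. - g1 (real n)) - - g (real N + 1/2)) \<longlonglongrightarrow> - l"
    using tendsto_minus[OF lim] by (simp add: sum_negf)
  from midpoint_sum_ge[where m = m, OF DERIV_minus[OF g] DERIV_minus[OF g1] DERIV_minus[OF g2] \<phi> le nonneg nonpos this]
  show ?thesis by (simp add: sum_negf)
qed

text \<open>
  Differentiation of \<open>P (ln x) x\<^bsup>-q\<^esup>\<close>: on the factor \<open>P\<close> it acts as \<open>P \<mapsto> P' - q P\<close>, and the exponent \<open>q\<close>
  grows by one.
\<close>

lemma DERIV_ln_exp_ln:
  fixes P :: "real \<Rightarrow> real"
  assumes "x > 0" "(P has_real_derivative P') (at (ln x))"
  shows "((\<lambda>x. P (ln x) * exp (- q * ln x)) has_real_derivative (P' - q * P (ln x)) * exp (- (q + 1) * ln x)) (at x)"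
proof -
  have exp: "exp (- (q + 1) * ln x) = exp (- q * ln x) * inverse x"
    using assms(1) by (simp add: ring_distribs exp_diff exp_minus divide_inverse)
  have P: "((\<lambda>x. P (ln x)) has_real_derivative P' * inverse x) (at x)"
    using assms(1) by (intro DERIV_chain2[of P P' ln x] assms(2)) (auto intro!: derivative_eq_intros simp: divide_inverse)
  have "((\<lambda>x. exp (- q * ln x)) has_real_derivative exp (- q * ln x) * (- q * inverse x)) (at x)"
    using assms(1) by (auto intro!: derivative_eq_intros simp: divide_inverse)
  from DERIV_mult[OF P this] show ?thesis
    unfolding exp by (simp add: algebra_simps)
qed

lemma sum_exp_terms_le_exp:
  assumes "(y::real) \<ge> 0"
  shows "(\<Sum>i\<le>j. y ^ i / fact i) \<le> exp y"
proof -
  have "(\<Sum>i\<in>{..j}. inverse (fact i) *\<^sub>R y ^ i) \<le> (\<Sum>i. inverse (fact i) *\<^sub>R y ^ i)"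
    using assms summable_exp_generic[of y] by (intro sum_le_suminf) auto
  then show ?thesis by (simp add: exp_def divide_inverse mult.commute)
qed

text \<open>
  The primitive of \<open>(ln x)\<^bsup>j\<^esup> x\<^bsup>-(p+1)\<^esup>\<close> that vanishes at infinity is \<open>- j! / p\<^bsup>j+1\<^esup>\<close> times the truncated
  exponential series at \<open>p ln x\<close> divided by the full one, and this ratio lies between \<open>0\<close> and \<open>1\<close>.
\<close>

lemma ln_power_tail:
  fixes p :: real
  assumes p: "p > 0"
  obtains \<phi> where
    "\<And>x. x \<ge> 1 \<Longrightarrow> (\<phi> has_real_derivative ln x ^ j * exp (- (p + 1) * ln x)) (at x)"
    "\<And>x. x \<ge> 1 \<Longrightarrow> - (fact j / p ^ (j + 1)) \<le> \<phi> x"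
    "\<And>x. x \<ge> 1 \<Longrightarrow> \<phi> x \<le> 0"
proof -
  define c where "c = fact j / p ^ (j + 1)"
  have c: "c \<ge> 0" using p by (simp add: c_def)
  define P where "P y = - c * (\<Sum>i\<le>j. (p * y) ^ i / fact i)" for y
  have P: "(P has_real_derivative - c * (p * (\<Sum>i<j. (p * y) ^ i / fact i))) (at y)" for y
  proof -
    have "((\<lambda>y. \<Sum>i\<le>j. (p * y) ^ i / fact i) has_real_derivative (\<Sum>i\<le>j. of_nat i * (p * y) ^ (i - 1) * p / fact i)) (at y)"
      by (auto intro!: derivative_eq_intros sum.cong)
    also have "(\<Sum>i\<le>j. of_nat i * (p * y) ^ (i - 1) * p / fact i) = (\<Sum>i<j. of_nat (Suc i) * (p * y) ^ i * p / fact (Suc i))"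
      by (simp add: sum.atMost_shift)
    also have "\<dots> = p * (\<Sum>i<j. (p * y) ^ i / fact i)"
      unfolding sum_distrib_left by (intro sum.cong) (auto simp: divide_simps simp del: of_nat_Suc)
    finally show ?thesis
      unfolding P_def [abs_def] by (rule DERIV_cmult)
  qed
  have P': "- c * (p * (\<Sum>i<j. (p * y) ^ i / fact i)) - p * P y = y ^ j" for y
  proof -
    have "- c * (p * (\<Sum>i<j. (p * y) ^ i / fact i)) - p * P y = c * p * ((p * y) ^ j / fact j)"
      by (simp add: P_def lessThan_Suc_atMost [symmetric] algebra_simps)
    also have "\<dots> = y ^ j" using p by (simp add: c_def power_mult_distrib field_simps)
    finally show ?thesis .
  qed
  show ?thesis
  proof
    fix x :: real assume x: "x \<ge> 1"
    show "((\<lambda>x. P (ln x) * exp (- p * ln x)) has_real_derivative ln x ^ j * exp (- (p + 1) * ln x)) (at x)"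
      using DERIV_ln_exp_ln[OF _ P, of x p] x by (simp only: P')
    define s where "s = (\<Sum>i\<le>j. (p * ln x) ^ i / fact i)"
    have s: "0 \<le> s" "s \<le> exp (p * ln x)"
      unfolding s_def using x p by (auto intro!: sum_nonneg sum_exp_terms_le_exp)
    have "s * exp (- p * ln x) \<le> exp (p * ln x) * exp (- p * ln x)"
      using s by (intro mult_right_mono) auto
    also have "\<dots> = 1" by (simp flip: exp_add)
    finally have "c * (s * exp (- p * ln x)) \<le> c * 1"
      using c by (intro mult_left_mono)
    then show "- (fact j / p ^ (j + 1)) \<le> P (ln x) * exp (- p * ln x)"
      by (simp add: P_def c_def s_def mult.assoc)
    show "P (ln x) * exp (- p * ln x) \<le> 0"
      using s(1) c by (simp add: P_def s_def)
  qed
qed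

text \<open>
  With \<open>g x = (ln x)\<^bsup>k\<^esup> x\<^bsup>-u\<^esup>\<close> the sequence is \<open>(\<Sum>n\<le>N. g' n) - g (N + 1/2)\<close>, the form to which
  \<open>midpoint_sum_ge\<close> and \<open>midpoint_sum_le\<close> apply.
\<close>

lemma tendsto_zeta_times_pole_deriv:
  assumes "u > -1"
  shows "(\<lambda>N. (\<Sum>n=1..N. (real k * ln (real n) ^ (k - 1) - u * ln (real n) ^ k) * exp (- (u + 1) * ln (real n)))
            - ln (real N + 1/2) ^ k * exp (- u * ln (real N + 1/2)))
         \<longlonglongrightarrow> (-1) ^ Suc k * zeta_times_pole_deriv k u"
proof -
  have "(\<lambda>N. (-1) ^ Suc k * Re (midpoint_zeta k N (of_real u))) \<longlonglongrightarrow> (-1) ^ Suc k * zeta_times_pole_deriv k u"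
    unfolding zeta_times_pole_deriv_def
    using assms by (intro tendsto_intros tendsto_higher_deriv_zeta_times_pole) auto
  moreover have "midpoint_zeta k N (of_real u) = of_real ((-1) ^ Suc k *
      ((\<Sum>n=1..N. (real k * ln (real n) ^ (k - 1) - u * ln (real n) ^ k) * exp (- (u + 1) * ln (real n)))
            - ln (real N + 1/2) ^ k * exp (- u * ln (real N + 1/2))))" for N
    unfolding midpoint_zeta_def
    by (simp add: sum_distrib_left algebra_simps flip: exp_of_real)
  then have "(-1) ^ Suc k * Re (midpoint_zeta k N (of_real u)) =
      (\<Sum>n=1..N. (real k * ln (real n) ^ (k - 1) - u * ln (real n) ^ k) * exp (- (u + 1) * ln (real n)))
            - ln (real N + 1/2) ^ k * exp (- u * ln (real N + 1/2))" for N
    by (simp only: Re_complex_of_real mult.assoc [symmetric] power_mult_distrib [symmetric]) simp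
  ultimately show ?thesis by simp
qed

section \<open>Logarithms and derivatives of the weights\<close>

lemma ln_numerals:
  "693146 / 1000000 \<le> ln (2::real)" "ln (2::real) \<le> 693149 / 1000000"
  "405464 / 1000000 \<le> ln (3/2::real)" "ln (3/2::real) \<le> 405466 / 1000000"
  "223143 / 1000000 \<le> ln (5/4::real)" "ln (5/4::real) \<le> 223144 / 1000000"
proof -
  have l2: "ln (2::real) \<in> {0.693146..0.693149}"
    using ln_approx_bounds[of 2 5] by (simp add: eval_nat_numeral)
  have l3: "ln (3/2::real) \<in> {0.405464..0.405466}"
    using ln_approx_bounds[of "3/2" 4] by (simp add: eval_nat_numeral)
  have l5: "ln (5/4::real) \<in> {0.223143..0.223144}"
    using ln_approx_bounds[of "5/4" 3] by (simp add: eval_nat_numeral)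
  show "693146 / 1000000 \<le> ln (2::real)" "ln (2::real) \<le> 693149 / 1000000"
  "405464 / 1000000 \<le> ln (3/2::real)" "ln (3/2::real) \<le> 405466 / 1000000"
  "223143 / 1000000 \<le> ln (5/4::real)" "ln (5/4::real) \<le> 223144 / 1000000"
    using l2 l3 l5 by simp_all
qed

lemma ln_products:
  "ln (3::real) = ln 2 + ln (3/2)" "ln (4::real) = 2 * ln 2"
  "ln (5/2::real) = ln 2 + ln (5/4)" "ln (9/2::real) = ln 2 + 2 * ln (3/2)"
  using ln_mult[of 2 "3/2"] ln_mult[of 2 2] ln_mult[of 2 "5/4"] ln_mult[of 2 "(3/2) * (3/2)"]
    ln_mult[of "3/2" "3/2"] by simp_all

lemma sum_upto_numerals:
  fixes f :: "nat \<Rightarrow> real"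
  shows "(\<Sum>n=1..1. f n) = f 1" "(\<Sum>n=1..2. f n) = f 1 + f 2" "(\<Sum>n=1..4. f n) = f 1 + f 2 + f 3 + f 4"
  by (simp_all add: eval_nat_numeral)

lemma DERIV_ln_weight:
  fixes u x :: real
  assumes x: "x > 0"
  shows "((\<lambda>x. ln x * exp (- u * ln x)) has_real_derivative (1 - u * ln x) * exp (- (u + 1) * ln x)) (at x)"
    and "((\<lambda>x. (1 - u * ln x) * exp (- (u + 1) * ln x)) has_real_derivative
           (u * (u + 1) * ln x - (2 * u + 1)) * exp (- (u + 2) * ln x)) (at x)"
    and "((\<lambda>x. (u * (u + 1) * ln x - (2 * u + 1)) * exp (- (u + 2) * ln x)) has_real_derivative
           (3 * u\<^sup>2 + 6 * u + 2 - u * (u + 1) * (u + 2) * ln x) * exp (- (u + 3) * ln x)) (at x)"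
proof -
  show "((\<lambda>x. ln x * exp (- u * ln x)) has_real_derivative (1 - u * ln x) * exp (- (u + 1) * ln x)) (at x)"
    by (rule DERIV_cong[OF DERIV_ln_exp_ln[OF x, of "\<lambda>y. y" 1 u]]) (auto intro!: derivative_eq_intros)
  show "((\<lambda>x. (1 - u * ln x) * exp (- (u + 1) * ln x)) has_real_derivative
           (u * (u + 1) * ln x - (2 * u + 1)) * exp (- (u + 2) * ln x)) (at x)"
    by (rule DERIV_cong[OF DERIV_ln_exp_ln[OF x, of "\<lambda>y. 1 - u * y" "- u" "u + 1"]])
       (auto intro!: derivative_eq_intros arg_cong2[where f = "(*)"] simp: algebra_simps)
  show "((\<lambda>x. (u * (u + 1) * ln x - (2 * u + 1)) * exp (- (u + 2) * ln x)) has_real_derivative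
           (3 * u\<^sup>2 + 6 * u + 2 - u * (u + 1) * (u + 2) * ln x) * exp (- (u + 3) * ln x)) (at x)"
    by (rule DERIV_cong[OF DERIV_ln_exp_ln[OF x, of "\<lambda>y. u * (u + 1) * y - (2 * u + 1)" "u * (u + 1)" "u + 2"]])
       (auto intro!: derivative_eq_intros arg_cong2[where f = "(*)"] simp: algebra_simps power2_eq_square)
qed

lemma DERIV_ln_cube_weight:
  fixes u x :: real
  assumes x: "x > 0"
  shows "((\<lambda>x. ln x ^ 3 * exp (- u * ln x)) has_real_derivative
           (3 * ln x ^ 2 - u * ln x ^ 3) * exp (- (u + 1) * ln x)) (at x)"
    and "((\<lambda>x. (3 * ln x ^ 2 - u * ln x ^ 3) * exp (- (u + 1) * ln x)) has_real_derivative
           (6 * ln x - (6 * u + 3) * ln x ^ 2 + u * (u + 1) * ln x ^ 3) * exp (- (u + 2) * ln x)) (at x)"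
    and "((\<lambda>x. (6 * ln x - (6 * u + 3) * ln x ^ 2 + u * (u + 1) * ln x ^ 3) * exp (- (u + 2) * ln x)) has_real_derivative
           (6 - 18 * (1 + u) * ln x + (6 + 18 * u + 9 * u\<^sup>2) * ln x ^ 2 - u * (u + 1) * (u + 2) * ln x ^ 3)
             * exp (- (u + 3) * ln x)) (at x)"
proof -
  show "((\<lambda>x. ln x ^ 3 * exp (- u * ln x)) has_real_derivative
           (3 * ln x ^ 2 - u * ln x ^ 3) * exp (- (u + 1) * ln x)) (at x)"
    by (rule DERIV_cong[OF DERIV_ln_exp_ln[OF x, of "\<lambda>y. y ^ 3" "3 * ln x ^ 2" u]])
       (auto intro!: derivative_eq_intros)
  show "((\<lambda>x. (3 * ln x ^ 2 - u * ln x ^ 3) * exp (- (u + 1) * ln x)) has_real_derivative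
           (6 * ln x - (6 * u + 3) * ln x ^ 2 + u * (u + 1) * ln x ^ 3) * exp (- (u + 2) * ln x)) (at x)"
    by (rule DERIV_cong[OF DERIV_ln_exp_ln[OF x, of "\<lambda>y. 3 * y ^ 2 - u * y ^ 3" "6 * ln x - 3 * u * ln x ^ 2" "u + 1"]])
       (auto intro!: derivative_eq_intros arg_cong2[where f = "(*)"] simp: algebra_simps)
  show "((\<lambda>x. (6 * ln x - (6 * u + 3) * ln x ^ 2 + u * (u + 1) * ln x ^ 3) * exp (- (u + 2) * ln x)) has_real_derivative
           (6 - 18 * (1 + u) * ln x + (6 + 18 * u + 9 * u\<^sup>2) * ln x ^ 2 - u * (u + 1) * (u + 2) * ln x ^ 3)
             * exp (- (u + 3) * ln x)) (at x)"
    by (rule DERIV_cong[OF DERIV_ln_exp_ln[OF x, of "\<lambda>y. 6 * y - (6 * u + 3) * y ^ 2 + u * (u + 1) * y ^ 3"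
          "6 - 2 * (6 * u + 3) * ln x + 3 * (u * (u + 1)) * ln x ^ 2" "u + 2"]])
       (auto intro!: derivative_eq_intros arg_cong2[where f = "(*)"] simp: algebra_simps power2_eq_square power3_eq_cube)
qed

section \<open>Bounds for the first and third derivative\<close>

text \<open>
  The four nonnegative quantities are, up to binomial factors, the coefficients of the cubic in the
  Bernstein basis of \<open>[0, 1]\<close>.
\<close>

lemma bernstein_cubic_nonneg:
  fixes u :: real
  assumes "0 \<le> u" "u \<le> 1" "0 \<le> r0" "0 \<le> 3 * r0 + r1" "0 \<le> 3 * r0 + 2 * r1 + r2" "0 \<le> r0 + r1 + r2 + r3"
  shows "0 \<le> r0 + r1 * u + r2 * u ^ 2 + r3 * u ^ 3"
proof -
  have "r0 + r1 * u + r2 * u ^ 2 + r3 * u ^ 3 =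
      r0 * (1 - u) ^ 3 + (3 * r0 + r1) * (u * (1 - u) ^ 2)
      + (3 * r0 + 2 * r1 + r2) * (u ^ 2 * (1 - u)) + (r0 + r1 + r2 + r3) * u ^ 3"
    by (simp add: power2_eq_square power3_eq_cube algebra_simps)
  also have "\<dots> \<ge> 0"
    using assms by (intro add_nonneg_nonneg mult_nonneg_nonneg[OF assms(3)] mult_nonneg_nonneg[OF assms(4)]
      mult_nonneg_nonneg[OF assms(5)] mult_nonneg_nonneg[OF assms(6)]) simp_all
  finally show ?thesis .
qed

text \<open>
  The left-hand side is the polynomial factor of the third derivative of \<open>(ln x)\<^sup>3 x\<^bsup>-u\<^esup>\<close> at \<open>y = ln x\<close>. For
  \<open>y \<ge> 0.9\<close> the negative linear term outweighs the constant by far, which leaves room for a small multiple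
  of \<open>y\<^sup>4\<close> to dominate the rest. The scaling by
  \<open>(u + 2)\<^sup>5\<close> makes the resulting tail bound independent of \<open>u\<close>, because the primitive of
  \<open>(ln x)\<^sup>4 x\<^bsup>-(u+3)\<^esup>\<close> is at most \<open>24 / (u + 2)\<^sup>5\<close> in absolute value.
\<close>

lemma cube_kernel_le:
  fixes u y :: real
  assumes u: "0 \<le> u" "u \<le> 1" and y: "(9 / 10) \<le> y"
  shows "6 - 18 * (1 + u) * y + (6 + 18 * u + 9 * u\<^sup>2) * y ^ 2 - u * (u + 1) * (u + 2) * y ^ 3
           \<le> 7 / 1000 * (u + 2) ^ 5 * y ^ 4"
proof -
  \<comment> \<open>The four Bernstein coefficients in \<open>u\<close>, for the lower bound \<open>32 + 80 u + 80 u\<^sup>2 + 40 u\<^sup>3\<close> of \<open>(u + 2)\<^sup>5\<close>. Each is a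
    quartic in \<open>y\<close> that is positive for \<open>y \<ge> 0.9\<close>; the identities write it as a sum of terms that are
    nonnegative there.\<close>
  have "(224 / 1000) * y ^ 4 - 6 * y ^ 2 + 18 * y - 6 =
      (224 / 1000) * ((y - (9 / 10)) * (y - (9 / 10))) ^ 2 + (8064 / 10000) * ((y - (9 / 10)) * (y - 4) ^ 2) + (8832 / 100000) * (y - (9 / 10)) ^ 2 + (10368 / 100000) * (y - (9 / 10)) + (54869664 / 10000000)"
    by algebra
  also have "\<dots> \<ge> 0"
    using y by (intro add_nonneg_nonneg mult_nonneg_nonneg) auto
  finally have r0: "0 \<le> (224 / 1000) * y ^ 4 - 6 * y ^ 2 + 18 * y - 6" .
  have "(1232 / 1000) * y ^ 4 + 2 * y ^ 3 - 36 * y ^ 2 + 72 * y - 18 =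
      (1232 / 1000) * ((y - (9 / 10)) * (y - (22 / 10))) ^ 2 + (96384 / 10000) * ((y - (9 / 10)) * (y - (24 / 10)) ^ 2) + (222064 / 100000) * (y - (23 / 10)) ^ 2 + (183904 / 1000000) * (y - (9 / 10)) + (155538608 / 10000000)"
    by algebra
  also have "\<dots> \<ge> 0"
    using y by (intro add_nonneg_nonneg mult_nonneg_nonneg) auto
  finally have r1: "0 \<le> (1232 / 1000) * y ^ 4 + 2 * y ^ 3 - 36 * y ^ 2 + 72 * y - 18" .
  have "(2352 / 1000) * y ^ 4 + 7 * y ^ 3 - 63 * y ^ 2 + 90 * y - 18 =
      (2352 / 1000) * ((y - (9 / 10)) * (y - (21 / 10))) ^ 2 + (21112 / 1000) * ((y - (9 / 10)) * (y - 2) ^ 2) + (1039024 / 100000) * (y - (211 / 100)) ^ 2 + (672928 / 10000000) * (y - (9 / 10)) + (3403796816 / 1000000000)"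
    by algebra
  also have "\<dots> \<ge> 0"
    using y by (intro add_nonneg_nonneg mult_nonneg_nonneg) auto
  finally have r2: "0 \<le> (2352 / 1000) * y ^ 4 + 7 * y ^ 3 - 63 * y ^ 2 + 90 * y - 18" .
  have "(1624 / 1000) * y ^ 4 + 6 * y ^ 3 - 33 * y ^ 2 + 36 * y - 6 =
      (1624 / 1000) * ((y - (9 / 10)) * (y - (15 / 10))) ^ 2 + (137952 / 10000) * ((y - (9 / 10)) * (y - (15 / 10)) ^ 2) + (706224 / 100000) * (y - (155 / 100)) ^ 2 + (130224 / 1000000) * (y - (9 / 10)) + (212571 / 100000)"
    by algebra
  also have "\<dots> \<ge> 0"
    using y by (intro add_nonneg_nonneg mult_nonneg_nonneg) auto
  finally have r3: "0 \<le> (1624 / 1000) * y ^ 4 + 6 * y ^ 3 - 33 * y ^ 2 + 36 * y - 6" .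
  have "0 \<le> ((224 / 1000) * y ^ 4 - 6 * y ^ 2 + 18 * y - 6)
      + ((56 / 100) * y ^ 4 + 2 * y ^ 3 - 18 * y ^ 2 + 18 * y) * u
      + ((56 / 100) * y ^ 4 + 3 * y ^ 3 - 9 * y ^ 2) * u ^ 2 + ((28 / 100) * y ^ 4 + y ^ 3) * u ^ 3"
  proof (rule bernstein_cubic_nonneg)
    show "0 \<le> (224 / 1000) * y ^ 4 - 6 * y ^ 2 + 18 * y - 6" by (rule r0)
    show "0 \<le> 3 * ((224 / 1000) * y ^ 4 - 6 * y ^ 2 + 18 * y - 6) + ((56 / 100) * y ^ 4 + 2 * y ^ 3 - 18 * y ^ 2 + 18 * y)"
      using r1 by (simp add: algebra_simps)
    show "0 \<le> 3 * ((224 / 1000) * y ^ 4 - 6 * y ^ 2 + 18 * y - 6) + 2 * ((56 / 100) * y ^ 4 + 2 * y ^ 3 - 18 * y ^ 2 + 18 * y)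
        + ((56 / 100) * y ^ 4 + 3 * y ^ 3 - 9 * y ^ 2)"
      using r2 by (simp add: algebra_simps)
    show "0 \<le> (224 / 1000) * y ^ 4 - 6 * y ^ 2 + 18 * y - 6 + ((56 / 100) * y ^ 4 + 2 * y ^ 3 - 18 * y ^ 2 + 18 * y)
        + ((56 / 100) * y ^ 4 + 3 * y ^ 3 - 9 * y ^ 2) + ((28 / 100) * y ^ 4 + y ^ 3)"
      using r3 by (simp add: algebra_simps)
  qed (use u in auto)
  moreover have "7 / 1000 * (32 + 80 * u + 80 * u ^ 2 + 40 * u ^ 3) * y ^ 4 \<le> 7 / 1000 * (u + 2) ^ 5 * y ^ 4"
  proof -
    have "(u + 2) ^ 5 = 32 + 80 * u + 80 * u ^ 2 + 40 * u ^ 3 + (10 * u ^ 4 + u ^ 5)"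
      by (simp add: eval_nat_numeral algebra_simps)
    moreover have "0 \<le> 10 * u ^ 4 + u ^ 5" using u by simp
    ultimately show ?thesis by (intro mult_right_mono mult_left_mono) auto
  qed
  moreover have "7 / 1000 * (32 + 80 * u + 80 * u ^ 2 + 40 * u ^ 3) * y ^ 4
      - (6 - 18 * (1 + u) * y + (6 + 18 * u + 9 * u\<^sup>2) * y ^ 2 - u * (u + 1) * (u + 2) * y ^ 3)
    = ((224 / 1000) * y ^ 4 - 6 * y ^ 2 + 18 * y - 6)
      + ((56 / 100) * y ^ 4 + 2 * y ^ 3 - 18 * y ^ 2 + 18 * y) * u
      + ((56 / 100) * y ^ 4 + 3 * y ^ 3 - 9 * y ^ 2) * u ^ 2 + ((28 / 100) * y ^ 4 + y ^ 3) * u ^ 3"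
    by algebra
  ultimately show ?thesis by linarith
qed

text \<open>
  The midpoint bound for \<open>g x = ln x * x\<^bsup>-u\<^esup>\<close> with only the term \<open>n = 1\<close> kept. Completing a square
  replaces the linear kernel by a multiple of \<open>(ln x)\<^sup>2\<close>.
\<close>

lemma zeta_deriv_le:
  assumes u: "u > 0"
  shows "zeta_times_pole_deriv 1 u \<le> 1 - ln (3/2) * exp (- u * ln (3/2)) + u * (u + 1) / (48 * (u + 2))"
proof -
  define B where "B = u * (u + 1) * (u + 2)"
  define c where "c = B * (u + 2) / 12"
  have B: "B > 0" "c > 0" using u by (auto simp: B_def c_def)
  obtain \<phi> where \<phi>: "\<And>x. x \<ge> 1 \<Longrightarrow> (\<phi> has_real_derivative ln x ^ 2 * exp (- (u + 2 + 1) * ln x)) (at x)"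
    "\<And>x. x \<ge> 1 \<Longrightarrow> - (fact 2 / (u + 2) ^ (2 + 1)) \<le> \<phi> x" "\<And>x. x \<ge> 1 \<Longrightarrow> \<phi> x \<le> 0"
    using ln_power_tail[of "u + 2" 2] u by auto
  have kernel: "B * y - (3 * u\<^sup>2 + 6 * u + 2) \<le> c * y ^ 2" for y
  proof -
    have "c * y ^ 2 - B * y + 3 * u * (u + 1) = u * (u + 1) / 12 * ((u + 2) * y - 6)\<^sup>2"
      by (simp add: c_def B_def power2_eq_square field_simps)
    also have "\<dots> \<ge> 0" using u by simp
    finally show ?thesis using u by (simp add: algebra_simps power2_eq_square)
  qed
  have "zeta_times_pole_deriv 1 u \<le> (\<Sum>n=1..1. (1 - u * ln (real n)) * exp (- (u + 1) * ln (real n)))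
      - ln (real 1 + 1/2) * exp (- u * ln (real 1 + 1/2)) - c * \<phi> (real 1 + 1/2) / 8"
  proof (rule midpoint_sum_le)
    show "((\<lambda>x. ln x * exp (- u * ln x)) has_real_derivative (1 - u * ln x) * exp (- (u + 1) * ln x)) (at x)"
      "((\<lambda>x. (1 - u * ln x) * exp (- (u + 1) * ln x)) has_real_derivative
           (u * (u + 1) * ln x - (2 * u + 1)) * exp (- (u + 2) * ln x)) (at x)"
      "((\<lambda>x. (u * (u + 1) * ln x - (2 * u + 1)) * exp (- (u + 2) * ln x)) has_real_derivative
           (3 * u\<^sup>2 + 6 * u + 2 - u * (u + 1) * (u + 2) * ln x) * exp (- (u + 3) * ln x)) (at x)"
      if "x \<ge> real 1 + 1/2" for x
      by (rule DERIV_ln_weight, use that in simp)+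
    show "((\<lambda>x. c * \<phi> x) has_real_derivative c * (ln x ^ 2 * exp (- (u + 2 + 1) * ln x))) (at x)"
      if "x \<ge> real 1 + 1/2" for x using that by (intro DERIV_cmult \<phi>) simp
    show "- ((3 * u\<^sup>2 + 6 * u + 2 - u * (u + 1) * (u + 2) * ln x) * exp (- (u + 3) * ln x))
        \<le> c * (ln x ^ 2 * exp (- (u + 2 + 1) * ln x))" for x
      using mult_right_mono[OF kernel[of "ln x"], of "exp (- (u + 3) * ln x)"]
      by (simp add: B_def algebra_simps)
    show "0 \<le> c * (ln x ^ 2 * exp (- (u + 2 + 1) * ln x))" for x using B by simp
    show "c * \<phi> x \<le> 0" if "x \<ge> real 1 + 1/2" for x
      using that B \<phi>(3)[of x] by (simp add: mult_nonneg_nonpos)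
    show "(\<lambda>N. (\<Sum>n=1..N. (1 - u * ln (real n)) * exp (- (u + 1) * ln (real n)))
            - ln (real N + 1/2) * exp (- u * ln (real N + 1/2))) \<longlonglongrightarrow> zeta_times_pole_deriv 1 u"
      using tendsto_zeta_times_pole_deriv[of u 1] u by simp
  qed
  also have "\<dots> = 1 - ln (3/2) * exp (- u * ln (3/2)) - c * \<phi> (3/2) / 8"
    by (simp only: sum_upto_numerals) simp
  finally have "zeta_times_pole_deriv 1 u \<le> 1 - ln (3/2) * exp (- u * ln (3/2)) - c * \<phi> (3/2) / 8" .
  moreover have "- (c * (2 / (u + 2) ^ 3)) \<le> c * \<phi> (3/2)"
  proof -
    have "c * - (2 / (u + 2) ^ 3) \<le> c * \<phi> (3/2)"
      using B \<phi>(2)[of "3/2"] by (intro mult_left_mono) auto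
    then show ?thesis by (simp only: mult_minus_right)
  qed
  moreover have "c * (2 / (u + 2) ^ 3) / 8 = u * (u + 1) / (48 * (u + 2))"
    using u by (simp add: c_def B_def power3_eq_cube divide_simps)
  ultimately show ?thesis by argo
qed

lemma exp_shift_numerals:
  fixes u :: real
  shows "exp (- (u + 1) * ln 2) = exp (- u * ln 2) / 2"
    and "exp (- (u + 2) * ln (5/2)) = 4 / 25 * exp (- u * ln (5/2))"
proof -
  have "- (u + 1) * L = - u * L + - L" "- (u + 2) * L = - u * L + (- L + - L)" for L
    by (simp_all add: algebra_simps)
  then have split: "exp (- (u + 1) * L) = exp (- u * L) * exp (- L)"
    "exp (- (u + 2) * L) = exp (- u * L) * (exp (- L) * exp (- L))" for L
    by (simp_all only: exp_add)
  have "exp (- ln 2) = 1 / (2::real)" "exp (- ln (5/2)) = 2 / (5::real)"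
    by (simp_all add: exp_minus)
  then show "exp (- (u + 1) * ln 2) = exp (- u * ln 2) / 2"
    "exp (- (u + 2) * ln (5/2)) = 4 / 25 * exp (- u * ln (5/2))"
    by (simp_all only: split)
qed

lemma ln_ge_if_ge_5_2:
  assumes "(x::real) \<ge> 5/2"
  shows "ln x \<ge> (9 / 10)"
proof -
  have "ln (5/2) \<le> ln x" using assms by simp
  then show ?thesis using ln_numerals(1,5) ln_products(3) by linarith
qed

text \<open>
  The midpoint bound for \<open>g x = ln x * x\<^bsup>-u\<^esup>\<close> with the terms \<open>n = 1, 2\<close> kept. Since \<open>ln x\<close> is at least
  \<open>0.9\<close> on the tail, the kernel is at most the constant \<open>2 (u + 2)\<close>, and the tail contributes at
  most one quarter of \<open>(5/2)\<^bsup>-(u+2)\<^esup>\<close>, that is \<open>(5/2)\<^bsup>-u\<^esup> / 25\<close>.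
\<close>

lemma zeta_deriv_ge:
  assumes u: "u \<ge> 0"
  shows "zeta_times_pole_deriv 1 u
           \<ge> 1 + (1 - u * ln 2) * exp (- u * ln 2) / 2 - (ln (5/2) + 1/25) * exp (- u * ln (5/2))"
proof -
  have shift: "u + 2 + 1 = u + 3" by simp
  have kernel: "3 * u\<^sup>2 + 6 * u + 2 - u * (u + 1) * (u + 2) * y \<le> 2 * (u + 2)" if "y \<ge> (9 / 10)" for y
  proof -
    have "u * (u + 1) * (u + 2) * (9 / 10) \<le> u * (u + 1) * (u + 2) * y"
      using u that by (intro mult_left_mono) auto
    \<comment> \<open>The cubic on the left is smallest near \<open>u = 1.03\<close>, which explains the square.\<close>
    moreover have "2 * (u + 2) - (3 * u\<^sup>2 + 6 * u + 2 - u * (u + 1) * (u + 2) * (9 / 10))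
        = ((9 / 10) * u + (1554 / 1000)) * (u - (103 / 100))\<^sup>2 + (4643 / 100000) * u + (3513614 / 10000000)"
      by algebra
    moreover have "\<dots> \<ge> 0" using u by (intro add_nonneg_nonneg mult_nonneg_nonneg) auto
    ultimately show ?thesis by linarith
  qed
  have "(\<Sum>n=1..2. (1 - u * ln (real n)) * exp (- (u + 1) * ln (real n)))
      - ln (real 2 + 1/2) * exp (- u * ln (real 2 + 1/2)) + - 2 * exp (- (u + 2) * ln (real 2 + 1/2)) / 8
      \<le> zeta_times_pole_deriv 1 u"
  proof (rule midpoint_sum_ge)
    fix x :: real assume x: "x \<ge> real 2 + 1/2"
    then have x0: "x > 0" by simp
    note DERIV_ln_weight[OF x0, of u]
    then show "((\<lambda>x. ln x * exp (- u * ln x)) has_real_derivative (1 - u * ln x) * exp (- (u + 1) * ln x)) (at x)"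
      "((\<lambda>x. (1 - u * ln x) * exp (- (u + 1) * ln x)) has_real_derivative
           (u * (u + 1) * ln x - (2 * u + 1)) * exp (- (u + 2) * ln x)) (at x)"
      "((\<lambda>x. (u * (u + 1) * ln x - (2 * u + 1)) * exp (- (u + 2) * ln x)) has_real_derivative
           (3 * u\<^sup>2 + 6 * u + 2 - u * (u + 1) * (u + 2) * ln x) * exp (- (u + 3) * ln x)) (at x)"
      by blast+
    show "((\<lambda>x. - 2 * exp (- (u + 2) * ln x)) has_real_derivative 2 * (u + 2) * exp (- (u + 3) * ln x)) (at x)"
      by (rule DERIV_cong[OF DERIV_ln_exp_ln[OF x0 DERIV_const, of "- 2" "u + 2"]]) (simp add: shift)
    show "(3 * u\<^sup>2 + 6 * u + 2 - u * (u + 1) * (u + 2) * ln x) * exp (- (u + 3) * ln x)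
        \<le> 2 * (u + 2) * exp (- (u + 3) * ln x)"
      by (intro mult_right_mono kernel ln_ge_if_ge_5_2) (use x in auto)
    show "0 \<le> 2 * (u + 2) * exp (- (u + 3) * ln x)" using u by simp
    show "- 2 * exp (- (u + 2) * ln x) \<le> 0" by simp
  next
    show "(\<lambda>N. (\<Sum>n=1..N. (1 - u * ln (real n)) * exp (- (u + 1) * ln (real n)))
            - ln (real N + 1/2) * exp (- u * ln (real N + 1/2))) \<longlonglongrightarrow> zeta_times_pole_deriv 1 u"
      using tendsto_zeta_times_pole_deriv[of u 1] u by simp
  qed
  moreover have "(\<Sum>n=1..2. (1 - u * ln (real n)) * exp (- (u + 1) * ln (real n)))
      = 1 + (1 - u * ln 2) * exp (- u * ln 2) / 2"
    unfolding sum_upto_numerals of_nat_numeral of_nat_1 ln_one exp_shift_numerals by simp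
  moreover have "real 2 + 1/2 = 5/2" by simp
  ultimately show ?thesis
    by (simp only: exp_shift_numerals) (simp add: algebra_simps)
qed

lemma sum_cube_weight:
  fixes u :: real
  shows "(\<Sum>n=1..2. (3 * ln (real n) ^ 2 - u * ln (real n) ^ 3) * exp (- (u + 1) * ln (real n)))
      = (3 * ln 2 ^ 2 - u * ln 2 ^ 3) * exp (- u * ln 2) / 2"
  unfolding sum_upto_numerals of_nat_numeral of_nat_1 ln_one exp_shift_numerals by simp

lemma tendsto_zeta_third_deriv:
  assumes "u > -1"
  shows "(\<lambda>N. (\<Sum>n=1..N. (3 * ln (real n) ^ 2 - u * ln (real n) ^ 3) * exp (- (u + 1) * ln (real n)))
            - ln (real N + 1/2) ^ 3 * exp (- u * ln (real N + 1/2))) \<longlonglongrightarrow> zeta_times_pole_deriv 3 u"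
  using tendsto_zeta_times_pole_deriv[OF assms, of 3] by simp

text \<open>
  The first two summands on the right are the terms \<open>n \<le> 2\<close> and the midpoint correction at \<open>5/2\<close>; the
  tail is estimated by \<open>cube_kernel_le\<close> and costs at most \<open>24 \<cdot> 0.007 / 8 = 0.021\<close>.
\<close>

lemma zeta_third_deriv_ge:
  assumes u: "0 \<le> u" "u \<le> 1"
  shows "zeta_times_pole_deriv 3 u
           \<ge> (3 * ln 2 ^ 2 - u * ln 2 ^ 3) * exp (- u * ln 2) / 2 - ln (5/2) ^ 3 * exp (- u * ln (5/2)) - (21 / 1000)"
proof -
  define q where "q = (u + 2) ^ 5"
  define c where "c = 7 / 1000 * q"
  have q: "q > 0" using u by (simp add: q_def)
  then have c: "c > 0" by (simp add: c_def)
  have shift: "u + 2 + 1 = u + 3" by simp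
  obtain \<phi> where \<phi>: "\<And>x. x \<ge> 1 \<Longrightarrow> (\<phi> has_real_derivative ln x ^ 4 * exp (- (u + 2 + 1) * ln x)) (at x)"
    "\<And>x. x \<ge> 1 \<Longrightarrow> - (fact 4 / (u + 2) ^ (4 + 1)) \<le> \<phi> x" "\<And>x. x \<ge> 1 \<Longrightarrow> \<phi> x \<le> 0"
    using ln_power_tail[of "u + 2" 4] u by auto
  have "(\<Sum>n=1..2. (3 * ln (real n) ^ 2 - u * ln (real n) ^ 3) * exp (- (u + 1) * ln (real n)))
      - ln (real 2 + 1/2) ^ 3 * exp (- u * ln (real 2 + 1/2)) + c * \<phi> (real 2 + 1/2) / 8
      \<le> zeta_times_pole_deriv 3 u"
  proof (rule midpoint_sum_ge)
    fix x :: real assume x: "x \<ge> real 2 + 1/2"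
    then have x0: "x > 0" and x1: "x \<ge> 1" by simp_all
    note DERIV_ln_cube_weight[OF x0, of u]
    then show "((\<lambda>x. ln x ^ 3 * exp (- u * ln x)) has_real_derivative
           (3 * ln x ^ 2 - u * ln x ^ 3) * exp (- (u + 1) * ln x)) (at x)"
      "((\<lambda>x. (3 * ln x ^ 2 - u * ln x ^ 3) * exp (- (u + 1) * ln x)) has_real_derivative
           (6 * ln x - (6 * u + 3) * ln x ^ 2 + u * (u + 1) * ln x ^ 3) * exp (- (u + 2) * ln x)) (at x)"
      "((\<lambda>x. (6 * ln x - (6 * u + 3) * ln x ^ 2 + u * (u + 1) * ln x ^ 3) * exp (- (u + 2) * ln x)) has_real_derivative
           (6 - 18 * (1 + u) * ln x + (6 + 18 * u + 9 * u\<^sup>2) * ln x ^ 2 - u * (u + 1) * (u + 2) * ln x ^ 3)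
             * exp (- (u + 3) * ln x)) (at x)"
      by blast+
    show "((\<lambda>x. c * \<phi> x) has_real_derivative c * (ln x ^ 4 * exp (- (u + 2 + 1) * ln x))) (at x)"
      by (intro DERIV_cmult \<phi> x1)
    have "ln x \<ge> (9 / 10)" using x by (intro ln_ge_if_ge_5_2) auto
    from mult_right_mono[OF cube_kernel_le[OF u this] exp_ge_zero[of "- (u + 3) * ln x"]]
    show "(6 - 18 * (1 + u) * ln x + (6 + 18 * u + 9 * u\<^sup>2) * ln x ^ 2 - u * (u + 1) * (u + 2) * ln x ^ 3)
             * exp (- (u + 3) * ln x) \<le> c * (ln x ^ 4 * exp (- (u + 2 + 1) * ln x))"
      by (simp only: c_def q_def mult.assoc [symmetric] shift)
    show "0 \<le> c * (ln x ^ 4 * exp (- (u + 2 + 1) * ln x))" using c by simp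
    show "c * \<phi> x \<le> 0" using c \<phi>(3)[OF x1] by (simp add: mult_nonneg_nonpos)
  next
    show "(\<lambda>N. (\<Sum>n=1..N. (3 * ln (real n) ^ 2 - u * ln (real n) ^ 3) * exp (- (u + 1) * ln (real n)))
            - ln (real N + 1/2) ^ 3 * exp (- u * ln (real N + 1/2))) \<longlonglongrightarrow> zeta_times_pole_deriv 3 u"
      using u by (intro tendsto_zeta_third_deriv) simp
  qed
  moreover have "real 2 + 1/2 = 5/2" by simp
  moreover have "- (168 / 1000) \<le> c * \<phi> (5/2)"
  proof -
    have "- (24 / q) \<le> \<phi> (5/2)"
      using \<phi>(2)[of "5/2"] by (simp add: q_def fact_numeral)
    then have "c * - (24 / q) \<le> c * \<phi> (5/2)"
      using c by (intro mult_left_mono) auto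
    moreover have "c * - (24 / q) = - (168 / 1000)"
      using q by (simp add: c_def)
    ultimately show ?thesis by linarith
  qed
  ultimately show ?thesis
    unfolding sum_cube_weight by (simp only:)
qed

text \<open>
  In this direction the kernel only has to be bounded from below. Its quadratic part is at least
  \<open>- 15/2\<close> by completing a square, and the cubic term is kept.
\<close>

lemma zeta_third_deriv_le:
  assumes u: "u \<ge> 0"
  shows "zeta_times_pole_deriv 3 u
           \<le> (3 * ln 2 ^ 2 - u * ln 2 ^ 3) * exp (- u * ln 2) / 2 - ln (5/2) ^ 3 * exp (- u * ln (5/2))
             + ((6 / 5) / (u + 2) * exp (- u * ln (5/2)) + 6 * u * (u + 1) / (u + 2) ^ 3) / 8"
proof -
  define B where "B = u * (u + 1) * (u + 2)"
  have shift: "u + 2 + 1 = u + 3" by simp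
  have num: "0 - (u + 2) * - ((15 / 2) / (u + 2)) = (15 / 2)" using u by (simp add: field_simps)
  have B: "B \<ge> 0" using u by (simp add: B_def)
  obtain \<phi> where \<phi>: "\<And>x. x \<ge> 1 \<Longrightarrow> (\<phi> has_real_derivative ln x ^ 3 * exp (- (u + 2 + 1) * ln x)) (at x)"
    "\<And>x. x \<ge> 1 \<Longrightarrow> - (fact 3 / (u + 2) ^ (3 + 1)) \<le> \<phi> x" "\<And>x. x \<ge> 1 \<Longrightarrow> \<phi> x \<le> 0"
    using ln_power_tail[of "u + 2" 3] u by auto
  have kernel: "- (6 - 18 * (1 + u) * y + (6 + 18 * u + 9 * u\<^sup>2) * y ^ 2 - u * (u + 1) * (u + 2) * y ^ 3)
      \<le> (15 / 2) + B * y ^ 3" for y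
  proof -
    have "(15 / 2) + B * y ^ 3 + (6 - 18 * (1 + u) * y + (6 + 18 * u + 9 * u\<^sup>2) * y ^ 2 - u * (u + 1) * (u + 2) * y ^ 3)
        = 6 * ((1 + u) * y - (15 / 10))\<^sup>2 + (6 * u + 3 * u\<^sup>2) * y\<^sup>2"
      unfolding B_def by algebra
    also have "\<dots> \<ge> 0" using u by simp
    finally show ?thesis by linarith
  qed
  have "zeta_times_pole_deriv 3 u \<le>
      (\<Sum>n=1..2. (3 * ln (real n) ^ 2 - u * ln (real n) ^ 3) * exp (- (u + 1) * ln (real n)))
      - ln (real 2 + 1/2) ^ 3 * exp (- u * ln (real 2 + 1/2))
      - (- ((15 / 2) / (u + 2)) * exp (- (u + 2) * ln (real 2 + 1/2)) + B * \<phi> (real 2 + 1/2)) / 8"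
  proof (rule midpoint_sum_le)
    fix x :: real assume x: "x \<ge> real 2 + 1/2"
    then have x0: "x > 0" and x1: "x \<ge> 1" by simp_all
    note DERIV_ln_cube_weight[OF x0, of u]
    then show "((\<lambda>x. ln x ^ 3 * exp (- u * ln x)) has_real_derivative
           (3 * ln x ^ 2 - u * ln x ^ 3) * exp (- (u + 1) * ln x)) (at x)"
      "((\<lambda>x. (3 * ln x ^ 2 - u * ln x ^ 3) * exp (- (u + 1) * ln x)) has_real_derivative
           (6 * ln x - (6 * u + 3) * ln x ^ 2 + u * (u + 1) * ln x ^ 3) * exp (- (u + 2) * ln x)) (at x)"
      "((\<lambda>x. (6 * ln x - (6 * u + 3) * ln x ^ 2 + u * (u + 1) * ln x ^ 3) * exp (- (u + 2) * ln x)) has_real_derivative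
           (6 - 18 * (1 + u) * ln x + (6 + 18 * u + 9 * u\<^sup>2) * ln x ^ 2 - u * (u + 1) * (u + 2) * ln x ^ 3)
             * exp (- (u + 3) * ln x)) (at x)"
      by blast+
    have "((\<lambda>x. - ((15 / 2) / (u + 2)) * exp (- (u + 2) * ln x)) has_real_derivative (15 / 2) * exp (- (u + 3) * ln x)) (at x)"
      by (rule DERIV_cong[OF DERIV_ln_exp_ln[OF x0 DERIV_const, of "- ((15 / 2) / (u + 2))" "u + 2"]])
         (simp only: num shift)
    moreover have "((\<lambda>x. B * \<phi> x) has_real_derivative B * (ln x ^ 3 * exp (- (u + 2 + 1) * ln x))) (at x)"
      by (intro DERIV_cmult \<phi> x1)
    ultimately have "((\<lambda>x. - ((15 / 2) / (u + 2)) * exp (- (u + 2) * ln x) + B * \<phi> x) has_real_derivative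
        (15 / 2) * exp (- (u + 3) * ln x) + B * (ln x ^ 3 * exp (- (u + 2 + 1) * ln x))) (at x)"
      by (rule DERIV_add)
    then show "((\<lambda>x. - ((15 / 2) / (u + 2)) * exp (- (u + 2) * ln x) + B * \<phi> x) has_real_derivative
        ((15 / 2) + B * ln x ^ 3) * exp (- (u + 3) * ln x)) (at x)"
      by (simp add: ring_distribs mult.assoc add.assoc)
    show "- ((6 - 18 * (1 + u) * ln x + (6 + 18 * u + 9 * u\<^sup>2) * ln x ^ 2 - u * (u + 1) * (u + 2) * ln x ^ 3)
             * exp (- (u + 3) * ln x)) \<le> ((15 / 2) + B * ln x ^ 3) * exp (- (u + 3) * ln x)"
      unfolding mult_minus_left [symmetric] by (intro mult_right_mono kernel) simp
    have "ln x \<ge> 0" using x1 by simp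
    then show "0 \<le> ((15 / 2) + B * ln x ^ 3) * exp (- (u + 3) * ln x)" using B by simp
    show "- ((15 / 2) / (u + 2)) * exp (- (u + 2) * ln x) + B * \<phi> x \<le> 0"
      using u B \<phi>(3)[OF x1] by (intro add_nonpos_nonpos) (simp_all add: mult_nonneg_nonpos)
  next
    show "(\<lambda>N. (\<Sum>n=1..N. (3 * ln (real n) ^ 2 - u * ln (real n) ^ 3) * exp (- (u + 1) * ln (real n)))
            - ln (real N + 1/2) ^ 3 * exp (- u * ln (real N + 1/2))) \<longlonglongrightarrow> zeta_times_pole_deriv 3 u"
      using u by (intro tendsto_zeta_third_deriv) simp
  qed
  moreover have "real 2 + 1/2 = 5/2" by simp
  moreover have "- (6 * u * (u + 1) / (u + 2) ^ 3) \<le> B * \<phi> (5/2)"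
  proof -
    have "B * - (6 / (u + 2) ^ 4) \<le> B * \<phi> (5/2)"
      using B \<phi>(2)[of "5/2"] by (intro mult_left_mono) (auto simp: fact_numeral)
    moreover have "B * - (6 / (u + 2) ^ 4) = - (6 * u * (u + 1) / (u + 2) ^ 3)"
      using u by (simp add: B_def divide_simps eval_nat_numeral)
    ultimately show ?thesis by linarith
  qed
  moreover have "- ((15 / 2) / (u + 2)) * (4 / 25 * e) = - ((6 / 5) / (u + 2) * e)" for e
    using u by (simp add: field_simps)
  ultimately show ?thesis
    unfolding sum_cube_weight by (simp only: exp_shift_numerals) argo
qed

section \<open>Rational bounds to the right of 1\<close>

lemma exp_minus_le_inverse_quadratic:
  fixes x :: real
  assumes "x \<ge> 0"
  shows "exp (- x) \<le> 1 / (1 + x + x\<^sup>2 / 2)"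
proof -
  have "1 + x + x\<^sup>2 / 2 \<le> exp x" by (rule exp_lower_Taylor_quadratic[OF assms])
  moreover have "1 + x + x\<^sup>2 / 2 > 0" using assms zero_le_power2[of x] by linarith
  ultimately have "inverse (exp x) \<le> inverse (1 + x + x\<^sup>2 / 2)"
    by (intro le_imp_inverse_le)
  then show ?thesis by (simp add: exp_minus inverse_eq_divide)
qed

lemma frac_leI:
  fixes a b c d :: real
  assumes "b > 0" "d > 0" "a * d \<le> c * b"
  shows "a / b \<le> c / d"
  using assms by (simp add: field_simps)

text \<open>
  The analytic core of the bound for \<open>u \<ge> 1\<close>, in the variable \<open>z = (u - 1) ln 2\<close>. The first summand
  changes sign at \<open>z = 0.3068\<close>; on either side the exponential is replaced by a rational bound in
  the favourable direction, and after clearing denominators only nonnegative coefficients remain.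
\<close>

lemma two_term_upper_bound:
  fixes z :: real
  assumes z: "z \<ge> 0"
  shows "(z - 3068 / 10000) * exp (- z) / 4 + (3826 / 10000) / (1 + 132 / 100 * z + 87 / 100 * z\<^sup>2)
           \<le> (588 / 100) / (19 + 722 / 100 * z)"
proof -
  define a :: real where "a = 3068 / 10000"
  define c :: real where "c = 3826 / 10000"
  define d1 where "d1 = 1 + 132 / 100 * z + 87 / 100 * z\<^sup>2"
  define d2 where "d2 = 19 + 722 / 100 * z"
  define d3 where "d3 = 1 + z + z\<^sup>2 / 2"
  have pos: "d1 > 0" "d2 > 0" "d3 > 0"
    using z by (auto simp: d1_def d2_def d3_def intro!: add_pos_nonneg)
  have "(z - a) * exp (- z) / 4 + c / d1 \<le> (588 / 100) / d2"
  proof (cases "z \<le> a")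
    case True
    have "(z - a) * exp (- z) \<le> (z - a) * (1 - z)"
      using True exp_ge_add_one_self[of "- z"] by (intro mult_left_mono_neg) auto
    then have "(z - a) * exp (- z) / 4 + c / d1 \<le> (z - a) * (1 - z) / 4 + c / d1" by simp
    also have "\<dots> = ((z - a) * (1 - z) / 4 * d1 + c) / d1" using pos by (simp add: add_divide_distrib)
    also have "\<dots> \<le> (588 / 100) / d2"
    proof (rule frac_leI)
      have "(588 / 100) * d1 - ((z - a) * (1 - z) / 4 * d1 + c) * d2 =
        679 / 10000 + 634669 / 500000 * z + 32800567 / 25000000 * z ^ 2 + 428507 / 10000000 * z ^ 3 + 223148331 / 50000000 * z ^ 4 + 31407 / 20000 * z ^ 5"
        unfolding a_def c_def d1_def d2_def by (simp add: eval_nat_numeral field_simps)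
      also have "\<dots> \<ge> 0" using z by (intro add_nonneg_nonneg mult_nonneg_nonneg) auto
      finally show "((z - a) * (1 - z) / 4 * d1 + c) * d2 \<le> (588 / 100) * d1" by linarith
    qed (use pos in auto)
    finally show ?thesis .
  next
    case False
    have "(z - a) * exp (- z) \<le> (z - a) * (1 / d3)"
      unfolding d3_def using False z by (intro mult_left_mono exp_minus_le_inverse_quadratic) auto
    then have "(z - a) * exp (- z) / 4 + c / d1 \<le> (z - a) * (1 / d3) / 4 + c / d1"
      by (intro add_right_mono divide_right_mono) auto
    also have "\<dots> = ((z - a) / 4 * d1 + c * d3) / (d1 * d3)" using pos by (simp add: field_simps)
    also have "\<dots> \<le> (588 / 100) / d2"
    proof (rule frac_leI)
      have "(588 / 100) * (d1 * d3) - ((z - a) / 4 * d1 + c * d3) * d2 =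
        679 / 10000 + 668619 / 500000 * z + 83599017 / 25000000 * z ^ 2 + 79094869 / 50000000 * z ^ 3 + 19749 / 20000 * z ^ 4"
        unfolding a_def c_def d1_def d2_def d3_def by (simp add: eval_nat_numeral field_simps)
      also have "\<dots> \<ge> 0" using z by (intro add_nonneg_nonneg mult_nonneg_nonneg) auto
      finally show "((z - a) / 4 * d1 + c * d3) * d2 \<le> (588 / 100) * (d1 * d3)" by linarith
    qed (use pos in auto)
    finally show ?thesis .
  qed
  then show ?thesis by (simp add: a_def c_def d1_def d2_def)
qed

lemma ln_5_2_bounds: "916289 / 1000000 \<le> ln (5/2::real)" "ln (5/2::real) \<le> 916293 / 1000000"
  using ln_numerals(1,2,5,6) ln_products(3) by linarith+

text \<open>
  The right-hand side is \<open>c\<^sup>2 / (c + k u)\<close> for \<open>c = 0.42\<close> and \<open>k = 0.15\<close>, the values of \<open>1 - \<gamma>\<close> and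
  \<open>- 2 \<gamma>\<^sub>1\<close> for which that bound is smallest within the precision established below.
\<close>

lemma zeta_deriv_ge_rational:
  assumes u: "u \<ge> 1"
  shows "1 - zeta_times_pole_deriv 1 u \<le> (588 / 100) / (14 + 5 * u)"
proof -
  define l where "l = ln (2::real)"
  define L where "L = ln (5/2::real)"
  define z where "z = (u - 1) * l"
  note l = ln_numerals(1,2)[folded l_def]
  note L = ln_5_2_bounds[folded L_def]
  have z: "z \<ge> 0" using u l by (simp add: z_def)
  have e2: "exp (- u * l) = exp (- z) / 2"
  proof -
    have "- u * l = - z + - l" by (simp add: z_def algebra_simps)
    then have "exp (- u * l) = exp (- z) * exp (- l)" by (simp only: exp_add)
    also have "exp (- l) = 1 / 2" by (simp add: l_def exp_minus)
    finally show ?thesis by simp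
  qed
  have e5: "exp (- u * L) \<le> 2 / 5 * (1 / (1 + 132 / 100 * z + 87 / 100 * z\<^sup>2))"
  proof -
    define y where "y = 132 / 100 * z"
    have "- u * L = - ((u - 1) * L) + - L" by (simp add: algebra_simps)
    then have "exp (- u * L) = exp (- ((u - 1) * L)) * exp (- L)" by (simp only: exp_add)
    also have "exp (- L) = 2 / 5" by (simp add: L_def exp_minus)
    also have "exp (- ((u - 1) * L)) \<le> exp (- y)"
    proof -
      have "(u - 1) * (132 / 100 * l) \<le> (u - 1) * L"
        using u l L by (intro mult_left_mono) auto
      then show ?thesis by (simp add: y_def z_def)
    qed
    also have "exp (- y) \<le> 1 / (1 + y + y\<^sup>2 / 2)"
      using z by (intro exp_minus_le_inverse_quadratic) (simp add: y_def)
    also have "\<dots> \<le> 1 / (1 + 132 / 100 * z + 87 / 100 * z\<^sup>2)"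
    proof (rule divide_left_mono)
      have "y\<^sup>2 / 2 = 8712 / 10000 * z\<^sup>2" by (simp add: y_def power_mult_distrib power2_eq_square)
      moreover have "87 / 100 * z\<^sup>2 \<le> 8712 / 10000 * z\<^sup>2" by (intro mult_right_mono) auto
      ultimately show "1 + 132 / 100 * z + 87 / 100 * z\<^sup>2 \<le> 1 + y + y\<^sup>2 / 2"
        unfolding y_def [symmetric] by linarith
    qed (use z in \<open>auto simp: y_def intro!: mult_pos_pos add_pos_nonneg\<close>)
    finally show ?thesis by (simp add: mult.commute)
  qed
  have "1 - zeta_times_pole_deriv 1 u \<le> (u * l - 1) * exp (- u * l) / 2 + (L + 1/25) * exp (- u * L)"
  proof -
    have "(u * l - 1) * x / 2 = - ((1 - u * l) * x / 2)" for x by (simp add: field_simps)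
    then show ?thesis
      using zeta_deriv_ge[of u] u unfolding l_def [symmetric] L_def [symmetric] by argo
  qed
  also have "\<dots> \<le> (z - 3068 / 10000) * exp (- z) / 4
      + (3826 / 10000) / (1 + 132 / 100 * z + 87 / 100 * z\<^sup>2)"
  proof (rule add_mono)
    have "u * l - 1 \<le> z - 3068 / 10000" using l by (simp add: z_def algebra_simps)
    then have "(u * l - 1) * exp (- z) \<le> (z - 3068 / 10000) * exp (- z)" by (intro mult_right_mono) auto
    then show "(u * l - 1) * exp (- u * l) / 2 \<le> (z - 3068 / 10000) * exp (- z) / 4"
      unfolding e2 by simp
    define d where "d = 1 / (1 + 132 / 100 * z + 87 / 100 * z\<^sup>2)"
    have "d \<ge> 0" using z by (simp add: d_def)
    have "(L + 1/25) * exp (- u * L) \<le> (L + 1/25) * (2 / 5 * d)"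
      using e5 L by (intro mult_left_mono) (auto simp: d_def)
    also have "\<dots> = ((L + 1/25) * 2 / 5) * d" by simp
    also have "\<dots> \<le> (3826 / 10000) * d" using L \<open>d \<ge> 0\<close> by (intro mult_right_mono) auto
    finally show "(L + 1/25) * exp (- u * L) \<le> (3826 / 10000) / (1 + 132 / 100 * z + 87 / 100 * z\<^sup>2)"
      by (simp add: d_def)
  qed
  also have "\<dots> \<le> (588 / 100) / (19 + 722 / 100 * z)"
    by (rule two_term_upper_bound[OF z])
  also have "\<dots> \<le> (588 / 100) / (14 + 5 * u)"
  proof (rule divide_left_mono)
    have "(u - 1) * 5 \<le> (u - 1) * (722 / 100 * l)" using u l by (intro mult_left_mono) auto
    then show "14 + 5 * u \<le> 19 + 722 / 100 * z" by (simp add: z_def)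
  qed (use u z in \<open>auto intro!: mult_pos_pos add_pos_nonneg\<close>)
  finally show ?thesis .
qed

text \<open>
  The left-hand side is \<open>(c - k u) / (1 + u\<^sup>2 / 8)\<close> for upper and lower estimates \<open>c = 0.427\<close> and
  \<open>k = 0.1435\<close> of \<open>1 - \<gamma>\<close> and \<open>- 2 \<gamma>\<^sub>1\<close>. A tangent line at \<open>u = 1\<close> is enough for \<open>(2/3)\<^bsup>u\<^esup>\<close>.
\<close>

lemma zeta_deriv_le_rational:
  assumes u: "1 \<le> u" "u \<le> 3"
  shows "(427 / 1000 - 1435 / 10000 * u) / (1 + u\<^sup>2 / 8) \<le> 1 - zeta_times_pole_deriv 1 u"
proof -
  define m where "m = ln (3/2::real)"
  define v where "v = u - 1"
  have uv: "u = 1 + v" and v: "0 \<le> v" "v \<le> 2" using u by (auto simp: v_def)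
  note m = ln_numerals(3,4)[folded m_def]
  have "1 + - (v * m) \<le> exp (- (v * m))" by (rule exp_ge_add_one_self)
  moreover have "v * m \<le> v * (406 / 1000)" using v m by (intro mult_left_mono) auto
  ultimately have e: "1 - 406 / 1000 * v \<le> exp (- (v * m))" by linarith
  have "- u * m = - (v * m) + - m" by (simp add: uv algebra_simps)
  then have "exp (- u * m) = exp (- (v * m)) * exp (- m)" by (simp only: exp_add)
  also have "exp (- m) = 2 / 3" by (simp add: m_def exp_minus)
  finally have exp: "m * exp (- u * m) = (m * 2 / 3) * exp (- (v * m))" by simp
  have "27 / 100 * (1 - 406 / 1000 * v) \<le> (m * 2 / 3) * (1 - 406 / 1000 * v)"
    using v m by (intro mult_right_mono) auto
  also have "\<dots> \<le> m * exp (- u * m)"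
    unfolding exp using e m by (intro mult_left_mono) auto
  finally have main: "27 / 100 * (1 - 406 / 1000 * v) - u * (u + 1) / (48 * (u + 2))
      \<le> 1 - zeta_times_pole_deriv 1 u"
    using zeta_deriv_le[of u] u unfolding m_def [symmetric] by linarith
  have "(427 / 1000 - 1435 / 10000 * u) / (1 + u\<^sup>2 / 8)
      \<le> (27 / 100 * (1 - 406 / 1000 * v) * (48 * (u + 2)) - u * (u + 1)) / (48 * (u + 2))"
  proof (rule frac_leI)
    have "(27 / 100 * (1 - 406 / 1000 * v) * (48 * (u + 2)) - u * (u + 1)) * (1 + u\<^sup>2 / 8)
        - (427 / 1000 - 1435 / 10000 * u) * (48 * (u + 2))
      = 333 / 500 + 30383 / 3125 * v + 7493 / 2500 * v ^ 2 - 2867 / 1250 * v ^ 3 - 2446 / 3125 * v ^ 4"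
      unfolding uv by (simp add: eval_nat_numeral field_simps)
    moreover have "v ^ 4 \<le> 4 * v ^ 2" "v ^ 3 \<le> 4 * v" "v ^ 2 \<le> 2 * v"
    proof -
      have "v * v \<le> 2 * 2" using v by (intro mult_mono) auto
      then have "v ^ 2 * (v * v) \<le> v ^ 2 * 4" "v * (v * v) \<le> v * 4" using v by (intro mult_left_mono; simp)+
      then show "v ^ 4 \<le> 4 * v ^ 2" "v ^ 3 \<le> 4 * v"
        by (simp_all add: power2_eq_square power3_eq_cube power4_eq_xxxx)
      show "v ^ 2 \<le> 2 * v" using v by (simp add: power2_eq_square mult_right_mono)
    qed
    ultimately show "(427 / 1000 - 1435 / 10000 * u) * (48 * (u + 2))
      \<le> (27 / 100 * (1 - 406 / 1000 * v) * (48 * (u + 2)) - u * (u + 1)) * (1 + u\<^sup>2 / 8)"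
      using v by linarith
  qed (use u in \<open>auto intro!: add_pos_nonneg\<close>)
  also have "\<dots> = 27 / 100 * (1 - 406 / 1000 * v) - u * (u + 1) / (48 * (u + 2))"
    using u by (simp add: diff_divide_distrib)
  finally show ?thesis using main by linarith
qed

text \<open>
  For \<open>u \<ge> 3\<close> all terms except \<open>n = 1\<close> are nonpositive, because \<open>u ln 2 > 1\<close>.
\<close>

lemma zeta_deriv_le_1:
  assumes u: "u \<ge> 3"
  shows "zeta_times_pole_deriv 1 u \<le> 1"
proof (rule LIMSEQ_le_const2)
  show "(\<lambda>N. (\<Sum>n=1..N. (1 - u * ln (real n)) * exp (- (u + 1) * ln (real n)))
            - ln (real N + 1/2) * exp (- u * ln (real N + 1/2))) \<longlonglongrightarrow> zeta_times_pole_deriv 1 u"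
    using tendsto_zeta_times_pole_deriv[of u 1] u by simp
  have "(\<Sum>n=1..N. (1 - u * ln (real n)) * exp (- (u + 1) * ln (real n)))
            - ln (real N + 1/2) * exp (- u * ln (real N + 1/2)) \<le> 1" if N: "N \<ge> 1" for N
  proof -
    have "(1 - u * ln (real n)) * exp (- (u + 1) * ln (real n)) \<le> 0" if "n \<in> {2..N}" for n
    proof -
      have "ln 2 \<le> ln (real n)" using that by simp
      then have "3 * (1 / 2) \<le> u * ln (real n)" using u ln_numerals(1) by (intro mult_mono) auto
      then show ?thesis by (intro mult_nonpos_nonneg) auto
    qed
    then have "(\<Sum>n=2..N. (1 - u * ln (real n)) * exp (- (u + 1) * ln (real n))) \<le> 0"
      by (intro sum_nonpos) auto
    moreover have "(\<Sum>n=1..N. (1 - u * ln (real n)) * exp (- (u + 1) * ln (real n)))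
        = 1 + (\<Sum>n=2..N. (1 - u * ln (real n)) * exp (- (u + 1) * ln (real n)))"
      using N by (simp add: sum.atLeast_Suc_atMost numeral_2_eq_2)
    moreover have "0 \<le> ln (real N + 1/2) * exp (- u * ln (real N + 1/2))"
      using N by simp
    ultimately show ?thesis by linarith
  qed
  then show "\<exists>M. \<forall>N\<ge>M. (\<Sum>n=1..N. (1 - u * ln (real n)) * exp (- (u + 1) * ln (real n)))
            - ln (real N + 1/2) * exp (- u * ln (real N + 1/2)) \<le> 1" by blast
qed

section \<open>The constants at the pole\<close>

lemma zeta_deriv_0: "zeta_times_pole_deriv 1 0 = euler_mascheroni"
proof (rule LIMSEQ_unique)
  show "(\<lambda>N. (\<Sum>n=1..N. (1 - 0 * ln (real n)) * exp (- (0 + 1) * ln (real n)))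
            - ln (real N + 1/2) * exp (- 0 * ln (real N + 1/2))) \<longlonglongrightarrow> zeta_times_pole_deriv 1 0"
    using tendsto_zeta_times_pole_deriv[of 0 1] by simp
  have "(\<lambda>N. ln (real N) - ln (real N + 1/2)) \<longlonglongrightarrow> 0"
    by real_asymp
  from tendsto_add[OF euler_mascheroni_LIMSEQ this]
  have "(\<lambda>N. harm N - ln (real N + 1/2)) \<longlonglongrightarrow> (euler_mascheroni :: real)" by simp
  moreover have "harm N = (\<Sum>n=1..N. (1 - 0 * ln (real n)) * exp (- (0 + 1) * ln (real n)))" for N
    unfolding harm_def by (intro sum.cong) (auto simp: exp_minus)
  ultimately show "(\<lambda>N. (\<Sum>n=1..N. (1 - 0 * ln (real n)) * exp (- (0 + 1) * ln (real n)))
            - ln (real N + 1/2) * exp (- 0 * ln (real N + 1/2))) \<longlonglongrightarrow> euler_mascheroni"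
    by simp
qed

lemma ln_9_2_bounds: "1504074 / 1000000 \<le> ln (9/2::real)" "ln (9/2::real) \<le> 1504081 / 1000000"
  using ln_numerals(1-4) ln_products(4) by linarith+

lemma exp_minus_2_ln_9_2: "exp (- 2 * ln (9/2)) = 4 / (81::real)"
proof -
  have "exp (- 2 * ln (9/2)) = exp (- ln (9/2)) * exp (- ln (9/2) :: real)" by (simp flip: exp_add)
  also have "exp (- ln (9/2)) = 2 / (9::real)" by (simp add: exp_minus)
  finally show ?thesis by simp
qed

text \<open>
  Four terms of the sum are kept. The third derivative \<open>2 / x\<^sup>3\<close> is positive, so the midpoint error has a
  known sign, and it is at most \<open>(2/9)\<^sup>2 / 8\<close>.
\<close>

lemma euler_mascheroni_complement_bounds:
  "42 / 100 \<le> 1 - (euler_mascheroni :: real)" "1 - (euler_mascheroni :: real) \<le> 427 / 1000"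
proof -
  define g1 where "g1 x = (1 - 0 * ln x) * exp (- (0 + 1) * ln x)" for x :: real
  define g3 where "g3 x = (3 * 0\<^sup>2 + 6 * 0 + 2 - 0 * (0 + 1) * (0 + 2) * ln x) * exp (- (0 + 3) * ln x)" for x :: real
  have lim: "(\<lambda>N. (\<Sum>n=1..N. g1 (real n)) - ln (real N + 1/2) * exp (- 0 * ln (real N + 1/2)))
      \<longlonglongrightarrow> zeta_times_pole_deriv 1 0"
    using tendsto_zeta_times_pole_deriv[of 0 1] by (simp add: g1_def)
  have g3: "g3 x = 2 * exp (- (2 + 1) * ln x)" for x by (simp add: g3_def)
  have half: "real 4 + 1/2 = 9/2" and exp_0: "exp (- 0 * x) = 1" for x :: real by simp_all
  have g1: "g1 (real n) = 1 / real n" if "n > 0" for n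
    using that by (simp add: g1_def exp_minus inverse_eq_divide)
  have sum: "(\<Sum>n=1..4. g1 (real n)) = 25 / 12"
    unfolding sum_upto_numerals using g1[of 1] g1[of 2] g1[of 3] g1[of 4] by simp
  have "zeta_times_pole_deriv 1 0 \<le> (\<Sum>n=1..4. g1 (real n)) - ln (real 4 + 1/2) * exp (- 0 * ln (real 4 + 1/2)) - 0 / 8"
  proof (rule midpoint_sum_le)
    fix x :: real assume "x \<ge> real 4 + 1/2"
    then have x: "x > 0" by simp
    show "((\<lambda>x. ln x * exp (- 0 * ln x)) has_real_derivative g1 x) (at x)"
      unfolding g1_def by (rule DERIV_ln_weight[OF x])
    show "(g1 has_real_derivative (0 * (0 + 1) * ln x - (2 * 0 + 1)) * exp (- (0 + 2) * ln x)) (at x)"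
      unfolding g1_def [abs_def] by (rule DERIV_ln_weight[OF x])
    show "((\<lambda>x. (0 * (0 + 1) * ln x - (2 * 0 + 1)) * exp (- (0 + 2) * ln x)) has_real_derivative g3 x) (at x)"
      unfolding g3_def by (rule DERIV_ln_weight[OF x])
    show "((\<lambda>_. 0) has_real_derivative 0) (at x)" by (rule DERIV_const)
    show "- g3 x \<le> 0" by (simp add: g3)
  qed (use lim in simp_all)
  then show "42 / 100 \<le> 1 - (euler_mascheroni :: real)"
    using ln_9_2_bounds unfolding sum zeta_deriv_0 half exp_0 by linarith
  have "(\<Sum>n=1..4. g1 (real n)) - ln (real 4 + 1/2) * exp (- 0 * ln (real 4 + 1/2))
      + - 1 * exp (- 2 * ln (real 4 + 1/2)) / 8 \<le> zeta_times_pole_deriv 1 0"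
  proof (rule midpoint_sum_ge)
    fix x :: real assume "x \<ge> real 4 + 1/2"
    then have x: "x > 0" by simp
    show "((\<lambda>x. ln x * exp (- 0 * ln x)) has_real_derivative g1 x) (at x)"
      unfolding g1_def by (rule DERIV_ln_weight[OF x])
    show "(g1 has_real_derivative (0 * (0 + 1) * ln x - (2 * 0 + 1)) * exp (- (0 + 2) * ln x)) (at x)"
      unfolding g1_def [abs_def] by (rule DERIV_ln_weight[OF x])
    show "((\<lambda>x. (0 * (0 + 1) * ln x - (2 * 0 + 1)) * exp (- (0 + 2) * ln x)) has_real_derivative g3 x) (at x)"
      unfolding g3_def by (rule DERIV_ln_weight[OF x])
    show "((\<lambda>x. - 1 * exp (- 2 * ln x)) has_real_derivative 2 * exp (- (2 + 1) * ln x)) (at x)"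
      by (rule DERIV_cong[OF DERIV_ln_exp_ln[OF x DERIV_const, of "- 1" 2]]) simp
    show "g3 x \<le> 2 * exp (- (2 + 1) * ln x)" by (simp add: g3)
  qed (use lim in simp_all)
  moreover note exp_minus_2_ln_9_2
  ultimately show "1 - (euler_mascheroni :: real) \<le> 427 / 1000"
    using ln_9_2_bounds unfolding sum zeta_deriv_0 half exp_0 by linarith
qed

text \<open>
  Four terms are kept because \<open>ln (9/2)\<close> just exceeds \<open>3/2\<close>: from there on the third derivative
  \<open>(4 ln x - 6) / x\<^sup>3\<close> of \<open>(ln x)\<^sup>2\<close> is nonnegative, the midpoint error has a known sign, and the function
  itself provides the majorant.
\<close>

lemma zeta_second_deriv_0_bounds:
  "1435 / 10000 \<le> zeta_times_pole_deriv 2 0" "zeta_times_pole_deriv 2 0 \<le> 15 / 100"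
proof -
  define g1 where "g1 x = 2 * ln x * exp (- 1 * ln x)" for x :: real
  define g2 where "g2 x = (2 - 2 * ln x) * exp (- 2 * ln x)" for x :: real
  define g3 where "g3 x = (4 * ln x - 6) * exp (- 3 * ln x)" for x :: real
  have lim: "(\<lambda>N. (\<Sum>n=1..N. g1 (real n)) - ln (real N + 1/2) ^ 2 * exp (- 0 * ln (real N + 1/2)))
      \<longlonglongrightarrow> - zeta_times_pole_deriv 2 0"
    using tendsto_zeta_times_pole_deriv[of 0 2] by (simp add: g1_def)
  have g: "((\<lambda>x. ln x ^ 2 * exp (- 0 * ln x)) has_real_derivative g1 x) (at x)"
    "(g1 has_real_derivative g2 x) (at x)" "(g2 has_real_derivative g3 x) (at x)" if x: "x > 0" for x
  proof -
    show "((\<lambda>x. ln x ^ 2 * exp (- 0 * ln x)) has_real_derivative g1 x) (at x)"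
      unfolding g1_def by (rule DERIV_cong[OF DERIV_ln_exp_ln[OF x, of "\<lambda>y. y ^ 2" "2 * ln x" 0]])
        (auto intro!: derivative_eq_intros)
    show "(g1 has_real_derivative g2 x) (at x)"
      unfolding g1_def [abs_def] g2_def
      by (rule DERIV_cong[OF DERIV_ln_exp_ln[OF x, of "\<lambda>y. 2 * y" 2 1]]) (auto intro!: derivative_eq_intros)
    show "(g2 has_real_derivative g3 x) (at x)"
      unfolding g2_def [abs_def] g3_def
      by (rule DERIV_cong[OF DERIV_ln_exp_ln[OF x, of "\<lambda>y. 2 - 2 * y" "- 2" 2]]) (auto intro!: derivative_eq_intros)
  qed
  have ln: "ln x \<ge> 15 / 10" if "x \<ge> real 4 + 1/2" for x
  proof -
    have "ln (9/2) \<le> ln x" using that by simp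
    then show ?thesis using ln_9_2_bounds by linarith
  qed
  have g2: "g2 (9/2) = (2 - 2 * ln (9/2)) * (4 / 81)"
    by (simp only: g2_def exp_minus_2_ln_9_2)
  have g1: "g1 (real n) = 2 * ln (real n) / real n" if "n > 0" for n
    using that by (simp add: g1_def exp_minus inverse_eq_divide)
  have sum: "(\<Sum>n=1..4. g1 (real n)) = 8 / 3 * ln 2 + 2 / 3 * ln (3/2)"
    unfolding sum_upto_numerals using g1[of 1] g1[of 2] g1[of 3] g1[of 4] ln_products(1,2) by simp
  have half: "real 4 + 1/2 = 9/2" and exp_0: "exp (- 0 * x) = 1" for x :: real by simp_all
  have "- zeta_times_pole_deriv 2 0 \<le> (\<Sum>n=1..4. g1 (real n)) - ln (real 4 + 1/2) ^ 2 * exp (- 0 * ln (real 4 + 1/2)) - 0 / 8"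
  proof (rule midpoint_sum_le)
    fix x :: real assume x: "x \<ge> real 4 + 1/2"
    then have x0: "x > 0" by simp
    show "((\<lambda>x. ln x ^ 2 * exp (- 0 * ln x)) has_real_derivative g1 x) (at x)"
      "(g1 has_real_derivative g2 x) (at x)" "(g2 has_real_derivative g3 x) (at x)" by (rule g[OF x0])+
    show "((\<lambda>_. 0) has_real_derivative 0) (at x)" by (rule DERIV_const)
    show "- g3 x \<le> 0" using ln[OF x] by (simp add: g3_def)
  qed (use lim in simp_all)
  moreover have "(1504074 / 1000000) ^ 2 \<le> ln (9/2::real) ^ 2"
    by (rule power_mono) (use ln_9_2_bounds in auto)
  ultimately show "1435 / 10000 \<le> zeta_times_pole_deriv 2 0"
    using ln_numerals(2,4) unfolding sum half exp_0 power2_eq_square by linarith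
  have "(\<Sum>n=1..4. g1 (real n)) - ln (real 4 + 1/2) ^ 2 * exp (- 0 * ln (real 4 + 1/2)) + g2 (real 4 + 1/2) / 8
      \<le> - zeta_times_pole_deriv 2 0"
  proof (rule midpoint_sum_ge)
    fix x :: real assume x: "x \<ge> real 4 + 1/2"
    then have x0: "x > 0" by simp
    show "((\<lambda>x. ln x ^ 2 * exp (- 0 * ln x)) has_real_derivative g1 x) (at x)"
      "(g1 has_real_derivative g2 x) (at x)" "(g2 has_real_derivative g3 x) (at x)"
      "(g2 has_real_derivative g3 x) (at x)" by (rule g[OF x0])+
    show "g3 x \<le> g3 x" by simp
    show "0 \<le> g3 x" "g2 x \<le> 0" using ln[OF x] by (simp_all add: g3_def g2_def mult_nonpos_nonneg)
  qed (use lim in simp_all)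
  moreover have "ln (9/2::real) ^ 2 \<le> (1504081 / 1000000) ^ 2"
    by (rule power_mono) (use ln_9_2_bounds in auto)
  ultimately show "zeta_times_pole_deriv 2 0 \<le> 15 / 100"
    using ln_numerals(1,3) ln_9_2_bounds unfolding sum half exp_0 g2 power2_eq_square by argo
qed

section \<open>The third derivative near the pole\<close>

text \<open>
  Convexity of the exponential function between \<open>0\<close> and \<open>a\<close>, obtained from its tangent line at \<open>t a\<close>.
\<close>

lemma exp_mult_le_chord:
  fixes a t :: real
  assumes "0 \<le> t" "t \<le> 1"
  shows "exp (t * a) \<le> 1 - t + t * exp a"
proof -
  have "exp (t * a) * (1 + (1 - t) * a) \<le> exp (t * a) * exp ((1 - t) * a)"
    by (intro mult_left_mono exp_ge_add_one_self) simp
  also have "\<dots> = exp a" unfolding exp_add [symmetric] by (simp add: algebra_simps)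
  finally have "t * (exp (t * a) * (1 + (1 - t) * a)) \<le> t * exp a"
    using assms by (intro mult_left_mono)
  moreover have "exp (t * a) * (1 + - (t * a)) \<le> exp (t * a) * exp (- (t * a))"
    by (intro mult_left_mono exp_ge_add_one_self) simp
  then have "(1 - t) * (exp (t * a) * (1 + - (t * a))) \<le> (1 - t) * 1"
    using assms by (intro mult_left_mono) (simp_all flip: exp_add)
  ultimately show ?thesis by (simp add: algebra_simps)
qed

text \<open>
  The main term is \<open>2\<^bsup>-t\<^esup>\<close> times a nearly linear function of \<open>t\<close>, because \<open>(5/2)\<^bsup>-t\<^esup> = 2\<^bsup>-t\<^esup> (5/4)\<^bsup>-t\<^esup>\<close> and
  \<open>(5/4)\<^bsup>-t\<^esup>\<close> varies little. The two parts of that function are each about \<open>0.75\<close> at \<open>t = 0\<close>, with a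
  difference of only about \<open>0.05\<close>; after factoring out \<open>2\<^bsup>-t\<^esup>\<close> they cancel in linear bounds.
\<close>

lemma zeta_third_deriv_bounds:
  fixes t :: real
  assumes t: "0 \<le> t" "t \<le> 1"
  shows "- 697 / 10000 \<le> zeta_times_pole_deriv 3 t" "zeta_times_pole_deriv 3 t \<le> 582 / 10000"
proof -
  define l where "l = ln (2::real)"
  define L where "L = ln (5/2::real)"
  define q where "q = ln (5/4::real)"
  define E where "E = exp (- t * l)"
  define w where "w = exp (- t * q)"
  define b where "b = L ^ 3 * w - (3 * l ^ 2 - t * l ^ 3) / 2"
  note l = ln_numerals(1,2)[folded l_def]
  note q = ln_numerals(5,6)[folded q_def]
  note L = ln_5_2_bounds[folded L_def]
  have exp_L: "exp (- t * L) = E * w"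
  proof -
    have "- t * L = - t * l + - t * q"
      using ln_products(3) by (simp add: L_def l_def q_def algebra_simps)
    then show ?thesis by (simp only: exp_add E_def w_def)
  qed
  \<comment> \<open>\<open>E * b\<close> is the main term of \<open>- F'''\<close>.\<close>
  have main: "(3 * l ^ 2 - t * l ^ 3) * exp (- t * l) / 2 - L ^ 3 * exp (- t * L) = - (E * b)"
    unfolding exp_L b_def E_def [symmetric] by (simp add: field_simps)
  have exp_q: "exp (- q) = 4 / 5" by (simp add: q_def exp_minus)
  \<comment> \<open>The cancellation in \<open>b\<close> requires the powers of the logarithms to about four digits.\<close>
  have l2: "480451 / 1000000 \<le> l ^ 2" "l ^ 2 \<le> 480456 / 1000000"
    using power_mono[of "693146 / 1000000" l 2] power_mono[of l "693149 / 1000000" 2] l by (simp_all add: power2_eq_square)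
  have l3: "333020 / 1000000 \<le> l ^ 3" "l ^ 3 \<le> 333030 / 1000000"
    using power_mono[of "693146 / 1000000" l 3] power_mono[of l "693149 / 1000000" 3] l by (simp_all add: power3_eq_cube)
  have L3: "769300 / 1000000 \<le> L ^ 3" "L ^ 3 \<le> 769320 / 1000000"
    using power_mono[of "916289 / 1000000" L 3] power_mono[of L "916293 / 1000000" 3] L by (simp_all add: power3_eq_cube)
  have tl3: "333020 / 1000000 * t \<le> t * l ^ 3" "t * l ^ 3 \<le> 333030 / 1000000 * t"
    using mult_left_mono[OF l3(1) t(1)] mult_left_mono[OF l3(2) t(1)] by simp_all
  have tl: "693146 / 1000000 * t \<le> t * l" using mult_left_mono[OF l(1) t(1)] by simp
  have E: "E > 0" by (simp add: E_def)
  have "E * b \<le> 487 / 10000"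
  proof -
    have "w \<le> 1 - t / 5"
      using exp_mult_le_chord[OF t, of "- q"] exp_q by (simp add: w_def)
    then have "L ^ 3 * w \<le> (769320 / 1000000) * (1 - t / 5)"
      using L3 t by (intro mult_mono) (auto simp: w_def)
    then have "b \<le> 487 / 10000 * (1 + t * l)"
      using l2 tl3 tl t unfolding b_def by argo
    then have "E * b \<le> 487 / 10000 * (E * (1 + t * l))"
      using mult_left_mono[of b "487 / 10000 * (1 + t * l)" E] E by (simp only: mult.left_commute)
    also have "E * (1 + t * l) \<le> E * exp (t * l)"
      using E by (intro mult_left_mono exp_ge_add_one_self) simp
    also have "\<dots> = 1" by (simp add: E_def flip: exp_add)
    finally show ?thesis by simp
  qed
  then show "- 697 / 10000 \<le> zeta_times_pole_deriv 3 t"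
    using zeta_third_deriv_ge[OF t] unfolding l_def [symmetric] L_def [symmetric] main by linarith
  have "269 / 10000 \<le> E * b"
  proof -
    have "w = 4 / 5 * exp ((1 - t) * q)"
    proof -
      have "- t * q = - q + (1 - t) * q" by (simp add: algebra_simps)
      then show ?thesis by (simp only: w_def exp_add exp_q)
    qed
    moreover have "1 + (1 - t) * q \<le> exp ((1 - t) * q)" by (rule exp_ge_add_one_self)
    moreover have "(1 - t) * (223143 / 1000000) \<le> (1 - t) * q" using q t by (intro mult_left_mono) auto
    ultimately have "4 / 5 * (1 + (1 - t) * (223143 / 1000000)) \<le> w" by argo
    then have "(769300 / 1000000) * (4 / 5 * (1 + (1 - t) * (223143 / 1000000))) \<le> L ^ 3 * w"
      using L3 L t by (intro mult_mono) (auto simp: w_def)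
    then have b: "319 / 10000 + 291 / 10000 * t \<le> b"
      using l2 tl3 t unfolding b_def by argo
    have "E = 1 / 2 * exp ((1 - t) * l)"
    proof -
      have "- t * l = - l + (1 - t) * l" by (simp add: algebra_simps)
      moreover have "exp (- l) = 1 / 2" by (simp add: l_def exp_minus)
      ultimately show ?thesis by (simp only: E_def exp_add)
    qed
    moreover have "1 + (1 - t) * l \<le> exp ((1 - t) * l)" by (rule exp_ge_add_one_self)
    moreover have "(1 - t) * (693146 / 1000000) \<le> (1 - t) * l" using l t by (intro mult_left_mono) auto
    ultimately have E': "1 / 2 * (1 + (1 - t) * (693146 / 1000000)) \<le> E" by argo
    have "t * t \<le> t * 1" using t by (intro mult_left_mono)
    moreover have "(1 / 2 * (1 + (1 - t) * (693146 / 1000000))) * (319 / 10000 + 291 / 10000 * t)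
        = 270056787 / 10000000000 + 135795956 / 10000000000 * t - 100852743 / 10000000000 * (t * t)"
      by (simp add: field_simps)
    ultimately have "269 / 10000 \<le> (1 / 2 * (1 + (1 - t) * (693146 / 1000000))) * (319 / 10000 + 291 / 10000 * t)"
      using t by linarith
    also have "\<dots> \<le> E * b"
      using E' b t E by (intro mult_mono) auto
    finally show ?thesis .
  qed
  moreover have "(6 / 5) / (t + 2) * exp (- t * L) + 6 * t * (t + 1) / (t + 2) ^ 3 \<le> 68 / 100"
  proof -
    have "1 + 9 / 10 * t \<le> exp (t * L)"
    proof -
      have "t * (9 / 10) \<le> t * L" using t L by (intro mult_left_mono) auto
      then show ?thesis using exp_ge_add_one_self[of "t * L"] by linarith
    qed
    then have "exp (- t * L) \<le> 1 / (1 + 9 / 10 * t)"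
      using t by (simp add: exp_minus field_simps)
    then have "(6 / 5) / (t + 2) * exp (- t * L) \<le> (6 / 5) / (t + 2) * (1 / (1 + 9 / 10 * t))"
      using t by (intro mult_left_mono) auto
    then have "(6 / 5) / (t + 2) * exp (- t * L) + 6 * t * (t + 1) / (t + 2) ^ 3
        \<le> (6 / 5) / (t + 2) * (1 / (1 + 9 / 10 * t)) + 6 * t * (t + 1) / (t + 2) ^ 3"
      by (rule add_right_mono)
    also have "\<dots> = ((6 / 5) * (t + 2) ^ 2 + 6 * t * (t + 1) * (1 + 9 / 10 * t)) / ((t + 2) ^ 3 * (1 + 9 / 10 * t))"
    proof -
      define x where "x = t + 2"
      define y where "y = 1 + 9 / 10 * t"
      have "x > 0" "y > 0" using t by (auto simp: x_def y_def)
      then have "(6 / 5) / x * (1 / y) + r / x ^ 3 = ((6 / 5) * x ^ 2 + r * y) / (x ^ 3 * y)" for r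
        by (simp add: add_divide_distrib power2_eq_square power3_eq_cube)
      then show ?thesis by (simp only: x_def y_def)
    qed
    also have "\<dots> \<le> 68 / 100"
    proof -
      have "t * t \<le> t * 1" using t by (intro mult_left_mono)
      moreover from this have "t * (t * t) \<le> t * 1" using t by (intro mult_left_mono) auto
      ultimately have "t ^ 2 \<le> t" "t ^ 3 \<le> t" by (simp_all add: power2_eq_square power3_eq_cube)
      moreover have "68 / 100 * ((t + 2) ^ 3 * (1 + 9 / 10 * t))
          - ((6 / 5) * (t + 2) ^ 2 + 6 * t * (t + 1) * (1 + 9 / 10 * t))
        = 64 / 100 + 2256 / 1000 * t - 1176 / 1000 * t ^ 2 - 1048 / 1000 * t ^ 3 + 612 / 1000 * t ^ 4"
        by (simp add: eval_nat_numeral field_simps)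
      moreover have "0 \<le> t ^ 4" using t by simp
      ultimately have "(6 / 5) * (t + 2) ^ 2 + 6 * t * (t + 1) * (1 + 9 / 10 * t)
          \<le> 68 / 100 * ((t + 2) ^ 3 * (1 + 9 / 10 * t))"
        using t by linarith
      then show ?thesis using t by (simp add: pos_divide_le_eq)
    qed
    finally show ?thesis .
  qed
  ultimately show "zeta_times_pole_deriv 3 t \<le> 582 / 10000"
    using zeta_third_deriv_le[OF t(1)] unfolding l_def [symmetric] L_def [symmetric] main by argo
qed

section \<open>The two-sided bound\<close>

theorem theorem2:
  fixes s :: real
  assumes "s > 1"
  shows "1 - (1 - euler_mascheroni)\<^sup>2 / (1 - euler_mascheroni - 2 * stieltjes 1 * (s - 1))
           \<le> deriv (\<lambda>t. (t - 1) * real_zeta t) s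
         \<and> deriv (\<lambda>t. (t - 1) * real_zeta t) s
           \<le> 1 - (1 - euler_mascheroni + 2 * stieltjes 1 * (s - 1)) / (1 + 1 / 8 * (s - 1)\<^sup>2)"
proof -
  define u where "u = s - 1"
  define c where "c = 1 - (euler_mascheroni :: real)"
  define k where "k = zeta_times_pole_deriv 2 0"
  define G where "G = 1 - zeta_times_pole_deriv 1 u"
  have u: "u > 0" using assms by (simp add: u_def)
  note c = euler_mascheroni_complement_bounds[folded c_def]
  note k = zeta_second_deriv_0_bounds[folded k_def]
  have pos: "c + k * u > 0" "1 + u\<^sup>2 / 8 > 0" using u c k by (auto intro!: add_pos_nonneg)
  have stieltjes: "2 * stieltjes 1 = - k"
    unfolding stieltjes_1_eq by (simp add: k_def zeta_times_pole_deriv_def)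
  have "G \<le> c\<^sup>2 / (c + k * u) \<and> (c - k * u) / (1 + u\<^sup>2 / 8) \<le> G"
  proof (cases "u \<le> 1")
    case True
    \<comment> \<open>Taylor expansion of \<open>F'\<close> at \<open>0\<close> with the remainder in \<open>F'''\<close>.\<close>
    have "\<exists>t>0. t < u \<and> zeta_times_pole_deriv 1 u =
        (\<Sum>m<2. zeta_times_pole_deriv (Suc m) 0 / fact m * u ^ m) + zeta_times_pole_deriv (Suc 2) t / fact 2 * u ^ 2"
      using Maclaurin[of u 2 "\<lambda>m. zeta_times_pole_deriv (Suc m)" "zeta_times_pole_deriv 1"]
        u DERIV_zeta_times_pole_deriv by auto
    then obtain t where t: "0 < t" "t < u"
      "zeta_times_pole_deriv 1 u = (1 - c) + k * u + zeta_times_pole_deriv 3 t / 2 * u\<^sup>2"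
      by (auto simp: numeral_2_eq_2 numeral_3_eq_3 c_def k_def zeta_deriv_0 [symmetric])
    define d where "d = - zeta_times_pole_deriv 3 t"
    have d: "d \<le> 697 / 10000" "- 582 / 10000 \<le> d"
      using zeta_third_deriv_bounds[of t] t True by (simp_all add: d_def)
    have G: "G = c - k * u + d / 2 * u\<^sup>2" using t(3) by (simp add: G_def d_def)
    have ku: "k * u \<le> k" "0 \<le> k * u" using True u k by (simp_all add: mult_left_le)
    have u2: "u\<^sup>2 \<le> 1" using True u by (simp add: power_le_one)
    have "G \<le> c\<^sup>2 / (c + k * u)"
    proof -
      \<comment> \<open>Cleared of denominators, the claim is \<open>d / 2 (c + k u) \<le> k\<^sup>2\<close>.\<close>
      have "d / 2 * (c + k * u) \<le> (697 / 20000) * (427 / 1000 + k)"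
        using d c ku pos by (intro mult_mono) auto
      also have "\<dots> \<le> k * k"
      proof -
        have "(1435 / 10000) * (1435 / 10000 - 697 / 20000) \<le> k * (k - 697 / 20000)"
          using k by (intro mult_mono) auto
        then show ?thesis by (simp add: algebra_simps)
      qed
      finally have "d / 2 * (c + k * u) * u\<^sup>2 \<le> k * k * u\<^sup>2" by (intro mult_right_mono) auto
      then have "G * (c + k * u) \<le> c\<^sup>2"
        by (simp add: G power2_eq_square algebra_simps)
      then show ?thesis using pos by (simp add: pos_le_divide_eq)
    qed
    moreover have "(c - k * u) / (1 + u\<^sup>2 / 8) \<le> G"
    proof -
      \<comment> \<open>The difference of the two sides, cleared of denominators, is \<open>u\<^sup>2\<close> times this quantity.\<close>
      have "0 \<le> (c - k * u) / 8 + d / 2 * (1 + u\<^sup>2 / 8)"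
      proof -
        have "- (582 / 10000) / 2 * (9 / 8) \<le> - (582 / 10000) / 2 * (1 + u\<^sup>2 / 8)"
          using u2 by (intro mult_left_mono_neg) auto
        also have "\<dots> \<le> d / 2 * (1 + u\<^sup>2 / 8)"
          using d pos by (intro mult_right_mono) auto
        finally show ?thesis using c k ku by argo
      qed
      then have "0 \<le> ((c - k * u) / 8 + d / 2 * (1 + u\<^sup>2 / 8)) * u\<^sup>2" by simp
      moreover have "(y + d / 2 * x) * (1 + x / 8) - y = (y / 8 + d / 2 * (1 + x / 8)) * x" for x y
        by (simp add: field_simps)
      ultimately have "c - k * u \<le> G * (1 + u\<^sup>2 / 8)"
        unfolding G by (metis diff_ge_0_iff_ge)
      then show ?thesis using pos by (simp add: pos_divide_le_eq)
    qed
    ultimately show ?thesis by blast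
  next
    case False
    then have u1: "u \<ge> 1" by simp
    have "G \<le> (588 / 100) / (14 + 5 * u)"
      using zeta_deriv_ge_rational[OF u1] by (simp add: G_def)
    also have "\<dots> \<le> c\<^sup>2 / (c + k * u)"
    proof (rule frac_leI)
      have "(588 / 100) * (c + k * u) \<le> (588 / 100) * (c + 15 / 100 * u)"
        using k u by (intro mult_left_mono add_left_mono mult_right_mono) auto
      also have "\<dots> = c * (588 / 100) + (42 / 100)\<^sup>2 * (5 * u)" by (simp add: power2_eq_square)
      also have "\<dots> \<le> c * (c * 14) + c\<^sup>2 * (5 * u)"
        using c u by (intro add_mono mult_left_mono mult_right_mono power_mono) auto
      also have "\<dots> = c\<^sup>2 * (14 + 5 * u)" by (simp add: power2_eq_square algebra_simps)
      finally show "(588 / 100) * (c + k * u) \<le> c\<^sup>2 * (14 + 5 * u)" .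
    qed (use u pos in auto)
    finally have upper: "G \<le> c\<^sup>2 / (c + k * u)" .
    have le: "c - k * u \<le> 427 / 1000 - 1435 / 10000 * u"
      using c mult_right_mono[OF k(1), of u] u by linarith
    have "(c - k * u) / (1 + u\<^sup>2 / 8) \<le> G"
    proof (cases "u \<le> 3")
      case True
      have "(c - k * u) / (1 + u\<^sup>2 / 8) \<le> (427 / 1000 - 1435 / 10000 * u) / (1 + u\<^sup>2 / 8)"
        using le pos by (intro divide_right_mono) auto
      also have "\<dots> \<le> G" using zeta_deriv_le_rational[OF u1 True] by (simp add: G_def)
      finally show ?thesis .
    next
      case False
      then have "c - k * u \<le> 0" using le by linarith
      then have "(c - k * u) / (1 + u\<^sup>2 / 8) \<le> 0" using pos by (simp add: divide_nonpos_pos)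
      also have "0 \<le> G" using zeta_deriv_le_1[of u] False by (simp add: G_def)
      finally show ?thesis .
    qed
    with upper show ?thesis by blast
  qed
  then show ?thesis
    unfolding deriv_real_zeta[OF assms] u_def [symmetric] c_def [symmetric] stieltjes
    by (simp add: G_def)
qed

end
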